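(* Let $\alpha_1,\alpha_2,\alpha_3$ be real parameters with $\alpha_3>0$, and consider the planar system $$\phi'=\phi^{3}y,\qquad y'=\alpha_1\phi^{6}+\alpha_2\phi^{4}+\alpha_3 .$$ (1) If $\alpha_1>0$, $\alpha_2<0$ and $0<\alpha_3<-\frac{4\alpha_2^{3}}{27\alpha_1^{2}}$, then there are distinct positive real numbers $u_1,u_2$ such that the equilibria of the system are exactly the two pairs $\widetilde P_{1,2}(\pm u_1,0)$ and $\widetilde P_{3,4}(\pm u_2,0)$, where $\widetilde P_{1}$ and $\widetilde P_2$ are centers and $\widetilde P_{3}$ and $\widetilde P_4$ are saddles. (2) If $\alpha_1>0$, $\alpha_2<0$ and $\alpha_3=-\frac{4\alpha_2^{3}}{27\alpha_1^{2}}$, then there is a positive real number $u_3$ such that the equilibria of the system are exactly the pair $\widetilde P_{5,6}(\pm u_3,0)$, and both are cusps. (3) If either $\alpha_1>0$ and $\alpha_2\geq 0$, or $\alpha_1>0$, $\alpha_2<0$ and $\alpha_3>-\frac{4\alpha_2^{3}}{27\alpha_1^{2}}$, then the system has no equilibrium. (4) If $\alpha_1<0$, then there is a positive real number $u_4$ such that the equilibria of the system are exactly the pair $\widetilde P_{7,8}(\pm u_4,0)$, and both are centers.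
   Context: The prime denotes $d/d\zeta$, and $(\phi,y)\in\mathbb{R}^2$. A center is an equilibrium having a punctured neighbourhood filled with periodic orbits surrounding it. A saddle is an equilibrium near which the phase portrait is locally topologically that of a saddle (for an equilibrium with invertible Jacobian matrix: the Jacobian has two real eigenvalues of opposite sign). A cusp is an isolated equilibrium having a neighbourhood that consists of exactly two hyperbolic sectors separated by two separatrices, one tending to the equilibrium as $\zeta\to+\infty$ and the other as $\zeta\to-\infty$. *)

theory Defs
  imports "HOL-Analysis.Analysis"
begin

definition is_solution :: "(real \<times> real \<Rightarrow> real \<times> real) \<Rightarrow> real set \<Rightarrow> (real \<Rightarrow> real \<times> real) \<Rightarrow> bool"
  where "is_solution F I x \<longleftrightarrow> (\<forall>t\<in>I. (x has_vector_derivative F (x t)) (at t within I))"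

definition equilibria :: "(real \<times> real \<Rightarrow> real \<times> real) \<Rightarrow> (real \<times> real) set"
  where "equilibria F = {p. F p = 0}"

definition periodic_orbit :: "(real \<times> real \<Rightarrow> real \<times> real) \<Rightarrow> (real \<times> real) set \<Rightarrow> bool"
  where "periodic_orbit F C \<longleftrightarrow>
    (\<exists>x T. is_solution F UNIV x \<and> T > 0 \<and> (\<forall>t. x (t + T) = x t) \<and> (\<exists>t. x t \<noteq> x 0) \<and> C = range x)"

definition is_center :: "(real \<times> real \<Rightarrow> real \<times> real) \<Rightarrow> real \<times> real \<Rightarrow> bool"
  where "is_center F p \<longleftrightarrow> p \<in> equilibria F \<and>
    (\<exists>U. open U \<and> p \<in> U \<and>
      (\<forall>q\<in>U - {p}. \<exists>C. periodic_orbit F C \<and> q \<in> C \<and> C \<subseteq> U \<and> p \<in> inside C))"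

text \<open>The oriented phase portrait of a vector field on a set \<open>S\<close> is described by the relation
  ``the solution starting at \<open>q\<close> reaches \<open>r\<close> after some time \<open>T \<ge> 0\<close> without leaving \<open>S\<close>''.
  A homeomorphism preserving and reflecting this relation maps orbit arcs in \<open>S\<close> to orbit arcs
  in \<open>R\<close> and respects the direction of time (though not the parametrisation).\<close>

definition flows_to :: "(real \<times> real \<Rightarrow> real \<times> real) \<Rightarrow> (real \<times> real) set \<Rightarrow> real \<times> real \<Rightarrow> real \<times> real \<Rightarrow> bool"
  where "flows_to F S q r \<longleftrightarrow>
    (\<exists>T\<ge>0. \<exists>x. is_solution F {0..T} x \<and> x ` {0..T} \<subseteq> S \<and> x 0 = q \<and> x T = r)"

definition orbit_equivalence ::
  "(real \<times> real \<Rightarrow> real \<times> real) \<Rightarrow> (real \<times> real) set \<Rightarrow> (real \<times> real \<Rightarrow> real \<times> real) \<Rightarrow> (real \<times> real) set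
    \<Rightarrow> (real \<times> real \<Rightarrow> real \<times> real) \<Rightarrow> bool"
  where "orbit_equivalence F S G R h \<longleftrightarrow> (\<exists>k. homeomorphism S R h k) \<and>
    (\<forall>q\<in>S. \<forall>r\<in>S. flows_to F S q r \<longleftrightarrow> flows_to G R (h q) (h r))"

definition linear_saddle :: "real \<times> real \<Rightarrow> real \<times> real"
  where "linear_saddle = (\<lambda>(a, b). (a, - b))"

text \<open>The last conjunct is the usual criterion at equilibria with invertible Jacobian; it is required
  in addition to the local topological description. \<open>J\<close> is the Jacobian as a linear map.\<close>

definition is_saddle :: "(real \<times> real \<Rightarrow> real \<times> real) \<Rightarrow> real \<times> real \<Rightarrow> bool"
  where "is_saddle F p \<longleftrightarrow> p \<in> equilibria F \<and>
    (\<exists>U V h. open U \<and> p \<in> U \<and> open V \<and> 0 \<in> V \<and> h p = 0 \<and>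
      orbit_equivalence F U linear_saddle V h) \<and>
    (\<forall>J. (F has_derivative J) (at p) \<and> bij J \<longrightarrow>
      (\<exists>l m. l < 0 \<and> 0 < m \<and> (\<exists>v. v \<noteq> 0 \<and> J v = l *\<^sub>R v) \<and> (\<exists>w. w \<noteq> 0 \<and> J w = m *\<^sub>R w)))"

text \<open>A (closed) hyperbolic sector at \<open>p\<close> carries the phase portrait of one quadrant of the linear
  saddle, with vertex \<open>p\<close>. On its sides \<open>A\<close> and \<open>B\<close> the flow goes towards \<open>p\<close> and away from \<open>p\<close>,
  respectively.\<close>

definition hyperbolic_sector ::
  "(real \<times> real \<Rightarrow> real \<times> real) \<Rightarrow> real \<times> real \<Rightarrow> (real \<times> real) set \<Rightarrow> (real \<times> real) set \<Rightarrow> (real \<times> real) set \<Rightarrow> bool"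
  where "hyperbolic_sector F p S A B \<longleftrightarrow>
    (\<exists>h. orbit_equivalence linear_saddle ({0..1} \<times> {0..1}) F S h \<and> h 0 = p \<and>
      A = h ` ({0} \<times> {0<..1}) \<and> B = h ` ({0<..1} \<times> {0}))"

definition is_cusp :: "(real \<times> real \<Rightarrow> real \<times> real) \<Rightarrow> real \<times> real \<Rightarrow> bool"
  where "is_cusp F p \<longleftrightarrow> p \<in> equilibria F \<and>
    (\<exists>W. open W \<and> p \<in> W \<and> equilibria F \<inter> W = {p}) \<and>
    (\<exists>S1 S2 A B. p \<in> interior (S1 \<union> S2) \<and> S1 \<inter> S2 = {p} \<union> A \<union> B \<and>
      hyperbolic_sector F p S1 A B \<and> hyperbolic_sector F p S2 A B \<and>
      (\<exists>x. is_solution F {0..} x \<and> A = x ` {0..} \<and> (x \<longlongrightarrow> p) at_top) \<and>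
      (\<exists>x. is_solution F {..0} x \<and> B = x ` {..0} \<and> (x \<longlongrightarrow> p) at_bot))"

definition planar_field :: "real \<Rightarrow> real \<Rightarrow> real \<Rightarrow> real \<times> real \<Rightarrow> real \<times> real"
  where "planar_field \<alpha>\<^sub>1 \<alpha>\<^sub>2 \<alpha>\<^sub>3 = (\<lambda>(\<phi>, y). (\<phi> ^ 3 * y, \<alpha>\<^sub>1 * \<phi> ^ 6 + \<alpha>\<^sub>2 * \<phi> ^ 4 + \<alpha>\<^sub>3))"

end

theory Submission
  imports Defs
begin

text \<open>Away from \<open>\<phi> = 0\<close> the system has the first integral \<open>y\<^sup>2 - Q(\<phi>)\<close> with \<open>Q' = 2 g / \<phi>\<^sup>3\<close>, where
  \<open>g = \<alpha>\<^sub>1 \<phi>\<^sup>6 + \<alpha>\<^sub>2 \<phi>\<^sup>4 + \<alpha>\<^sub>3\<close>. With \<open>Q(u) = 0\<close> at an equilibrium \<open>(u, 0)\<close>,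
  \<open>Q = (\<phi>\<^sup>2 - u\<^sup>2)\<^sup>2 (\<alpha>\<^sub>1 (\<phi>\<^sup>2 / 2 + u\<^sup>2) + \<alpha>\<^sub>2) / \<phi>\<^sup>2\<close>, so if the last factor does not vanish at \<open>u\<close> then
  \<open>\<plusminus>Q = s\<^sup>2\<close> for a local coordinate \<open>s\<close>. In the coordinates \<open>(s, y)\<close> the field is a positive multiple of
  the linear saddle or of a rotation, and explicit orbits are transported back by a time change; no
  existence theorem for ODEs is needed. If the factor vanishes at \<open>u\<close>, then \<open>(z, c) = (\<bar>\<phi>\<bar> y, y\<^sup>2 - Q)\<close>
  maps the half plane containing \<open>u\<close> homeomorphically onto the plane; there the orbits are horizontal and
  \<open>z' = \<bar>\<phi>\<bar> (g + \<phi>\<^sup>2 y\<^sup>2)\<close> is positive except at the equilibrium.\<close>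

section \<open>Time changes and diffeomorphisms\<close>

text \<open>The obstacle is the degenerate equilibrium. There the chart (z, c) has a derivative of
  rank one, so it is a homeomorphism but not a diffeomorphism, and a change of coordinates compares
  orbits only on the punctured set. The puncture is filled in afterwards: the field is bounded by a
  multiple of the distance to the equilibrium, so by Gronwall a solution that meets it is constant
  and one that tends to it needs infinite time. The factor |\<phi>| in z is essential. The pair (y,
  c) would also separate the points of the half plane, but y' = g and the \<phi>-derivative of c
  both vanish on the whole line \<phi> = u, whereas z' vanishes at a single point. Positive factors
  in front of a field are harmless throughout, because \<open>flows_to\<close> asks only for some
  duration and a factor can be absorbed into the clock. The outgoing separatrix of the cusp is
  obtained from the incoming one by the reversibility of the system under y -> -y with time
  reversed.\<close>

lemma has_real_derivative_inverse_within:
  fixes f g :: "real \<Rightarrow> real"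
  assumes f: "(f has_real_derivative D) (at x within I)" and D: "D \<noteq> 0"
    and hom: "homeomorphism I J f g" and x: "x \<in> I"
  shows "(g has_real_derivative inverse D) (at (f x) within J)"
proof -
  have gf: "g (f x) = x" and fxJ: "f x \<in> J"
    using hom x by (auto simp: homeomorphism_def)
  have "continuous_on J g" using hom by (auto simp: homeomorphism_def)
  then have "(g \<longlongrightarrow> g (f x)) (at (f x) within J)"
    using fxJ by (auto simp: continuous_on_def)
  then have lim: "filterlim g (at x within I) (at (f x) within J)"
    using hom fxJ gf unfolding filterlim_at
    by (auto simp: eventually_at_filter homeomorphism_def intro!: always_eventually)
  \<comment> \<open>All limits are taken within \<open>I\<close> and \<open>J\<close>, which covers
    endpoints of closed time intervals. The difference quotient of \<open>g\<close> at
    \<open>w\<close> is the reciprocal of that of \<open>f\<close> at \<open>g w\<close>, and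
    continuity of \<open>g\<close> carries the limit over.\<close>
  have "((\<lambda>z. (f z - f x) / (z - x)) \<longlongrightarrow> D) (at x within I)"
    using f by (simp add: has_field_derivative_iff)
  from filterlim_compose[OF this lim]
  have "((\<lambda>w. (f (g w) - f x) / (g w - x)) \<longlongrightarrow> D) (at (f x) within J)" .
  from tendsto_inverse[OF this D]
  have "((\<lambda>w. (g w - x) / (f (g w) - f x)) \<longlongrightarrow> inverse D) (at (f x) within J)"
    by simp
  moreover have "eventually (\<lambda>w. (g w - x) / (f (g w) - f x) = (g w - g (f x)) / (w - f x)) (at (f x) within J)"
    using hom gf by (auto simp: eventually_at_filter homeomorphism_def intro!: always_eventually)
  ultimately have "((\<lambda>w. (g w - g (f x)) / (w - f x)) \<longlongrightarrow> inverse D) (at (f x) within J)"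
    using tendsto_cong by fast
  then show ?thesis by (simp add: has_field_derivative_iff)
qed

lemma has_real_derivative_pos_imp_strict_mono_on:
  fixes \<tau> :: "real \<Rightarrow> real"
  assumes I: "is_interval I"
    and \<tau>: "\<And>t. t \<in> I \<Longrightarrow> (\<tau> has_real_derivative \<kappa> t) (at t within I)"
    and pos: "\<And>t. t \<in> I \<Longrightarrow> \<kappa> t > 0"
  shows "strict_mono_on I \<tau>"
proof (rule strict_mono_onI)
  fix a b assume ab: "a \<in> I" "b \<in> I" "a < b"
  have sub: "{a..b} \<subseteq> I" using I ab by (metis atLeastAtMost_iff mem_is_interval_1_I subsetI)
  have "\<exists>x\<in>{a<..<b}. \<tau> b - \<tau> a = (*) (\<kappa> x) (b - a)"
  proof (rule mvt_simple[OF \<open>a < b\<close>])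
    fix x assume "a \<le> x" "x \<le> b"
    then have "x \<in> I" using sub by auto
    from has_derivative_subset[OF \<tau>[OF this, unfolded has_field_derivative_def] sub]
    show "(\<tau> has_derivative (*) (\<kappa> x)) (at x within {a..b})" .
  qed
  then obtain x where x: "x \<in> {a<..<b}" "\<tau> b - \<tau> a = \<kappa> x * (b - a)" by auto
  then have "x \<in> I" using sub greaterThanLessThan_subseteq_atLeastAtMost_iff by blast
  then have "\<kappa> x > 0" using pos by blast
  then show "\<tau> a < \<tau> b" using x ab by (smt (verit) mult_pos_pos)
qed

text \<open>The inverse clock \<sigma> has derivative 1/\<kappa>, which cancels the factor in the
  velocity of \<gamma>. An explicit curve that follows \<open>F\<close> up to a positive factor thus
  becomes a genuine solution with the same trace.\<close>

lemma is_solution_time_change: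
  fixes \<gamma> :: "real \<Rightarrow> real \<times> real"
  assumes I: "is_interval I"
    and \<gamma>: "\<And>t. t \<in> I \<Longrightarrow> (\<gamma> has_vector_derivative \<kappa> t *\<^sub>R F (\<gamma> t)) (at t within I)"
    and \<tau>: "\<And>t. t \<in> I \<Longrightarrow> (\<tau> has_real_derivative \<kappa> t) (at t within I)"
    and pos: "\<And>t. t \<in> I \<Longrightarrow> \<kappa> t > 0"
  obtains \<sigma> where "homeomorphism I (\<tau> ` I) \<tau> \<sigma>" "is_solution F (\<tau> ` I) (\<gamma> \<circ> \<sigma>)"
proof -
  have "strict_mono_on I \<tau>"
    using has_real_derivative_pos_imp_strict_mono_on[OF I \<tau> pos] .
  then have inj: "inj_on \<tau> I" by (rule strict_mono_on_imp_inj_on)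
  have cont: "continuous_on I \<tau>"
    using \<tau> by (meson DERIV_continuous_on)
  have "path_connected I"
    using I by (simp add: is_interval_path_connected)
  then obtain \<sigma> where hom: "homeomorphism I (\<tau> ` I) \<tau> \<sigma>"
    using homeomorphism_into_1d[OF _ cont refl inj] by blast
  have "is_solution F (\<tau> ` I) (\<gamma> \<circ> \<sigma>)"
    unfolding is_solution_def
  proof
    fix s assume "s \<in> \<tau> ` I"
    then obtain t where t: "t \<in> I" "s = \<tau> t" by auto
    have \<sigma>t: "\<sigma> s = t" and img: "\<sigma> ` (\<tau> ` I) = I"
      using hom t by (auto simp: homeomorphism_def)
    have "(\<sigma> has_real_derivative inverse (\<kappa> t)) (at s within \<tau> ` I)"
      using has_real_derivative_inverse_within[OF \<tau>[OF t(1)] _ hom t(1)] pos[OF t(1)] t by auto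
    then have 1: "(\<sigma> has_vector_derivative inverse (\<kappa> t)) (at s within \<tau> ` I)"
      by (simp add: has_real_derivative_iff_has_vector_derivative)
    have "(\<gamma> \<circ> \<sigma> has_vector_derivative inverse (\<kappa> t) *\<^sub>R (\<kappa> t *\<^sub>R F (\<gamma> t))) (at s within \<tau> ` I)"
      using vector_diff_chain_within[OF 1, of \<gamma> "\<kappa> t *\<^sub>R F (\<gamma> t)"] \<gamma>[OF t(1)]
      unfolding \<sigma>t img by blast
    then show "(\<gamma> \<circ> \<sigma> has_vector_derivative F ((\<gamma> \<circ> \<sigma>) s)) (at s within \<tau> ` I)"
      using pos[OF t(1)] \<sigma>t by simp
  qed
  with hom that show thesis by blast
qed

lemma strict_mono_on_image_atLeastAtMost:
  fixes \<tau> :: "real \<Rightarrow> real"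
  assumes "a \<le> b" "continuous_on {a..b} \<tau>" "strict_mono_on {a..b} \<tau>"
  shows "\<tau> ` {a..b} = {\<tau> a..\<tau> b}"
proof (intro equalityI subsetI)
  fix y assume "y \<in> \<tau> ` {a..b}"
  then show "y \<in> {\<tau> a..\<tau> b}"
    using strict_mono_on_leD[OF assms(3)] assms(1) by auto
next
  fix y assume "y \<in> {\<tau> a..\<tau> b}"
  then show "y \<in> \<tau> ` {a..b}"
    using IVT'[OF _ _ assms(1,2), of y] by auto
qed

text \<open>The image of a solution \<open>x\<close> has velocity \<kappa> times \<open>G\<close>,
  and the integral of \<kappa> along \<open>x\<close> serves as its new time. Since \<kappa> is
  positive, the direction of time is kept.\<close>

lemma flows_to_push:
  assumes deriv: "\<And>x. x \<in> S \<Longrightarrow> (\<Phi> has_derivative D x) (at x within S)"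
    and push: "\<And>x. x \<in> S \<Longrightarrow> D x (F x) = \<kappa> x *\<^sub>R G (\<Phi> x)"
    and pos: "\<And>x. x \<in> S \<Longrightarrow> \<kappa> x > (0::real)"
    and cont: "continuous_on S \<kappa>"
    and flow: "flows_to F S q r"
  shows "flows_to G (\<Phi> ` S) (\<Phi> q) (\<Phi> r)"
proof -
  obtain T x where T: "T \<ge> 0" and sol: "is_solution F {0..T} x" and img: "x ` {0..T} \<subseteq> S"
    and x0: "x 0 = q" and xT: "x T = r"
    using flow unfolding flows_to_def by auto
  have contx: "continuous_on {0..T} x"
    using sol unfolding is_solution_def
    by (metis continuous_on_eq_continuous_within has_vector_derivative_continuous)
  have "continuous_on {0..T} (\<lambda>t. \<kappa> (x t))"
    using continuous_on_compose2[OF cont contx img] .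
  then obtain \<tau> where \<tau>: "\<And>t. t \<in> {0..T} \<Longrightarrow> (\<tau> has_vector_derivative \<kappa> (x t)) (at t within {0..T})"
    using antiderivative_continuous by blast
  define \<tau>0 where "\<tau>0 t = \<tau> t - \<tau> 0" for t
  have \<tau>0: "(\<tau>0 has_real_derivative \<kappa> (x t)) (at t within {0..T})" if "t \<in> {0..T}" for t
    unfolding \<tau>0_def has_real_derivative_iff_has_vector_derivative
    using has_vector_derivative_diff[OF \<tau>[OF that] has_vector_derivative_const] by simp
  have pos': "\<kappa> (x t) > 0" if "t \<in> {0..T}" for t
    using pos img that by blast
  have \<gamma>: "(\<Phi> \<circ> x has_vector_derivative \<kappa> (x t) *\<^sub>R G ((\<Phi> \<circ> x) t)) (at t within {0..T})"
    if t: "t \<in> {0..T}" for t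
  proof -
    have xt: "x t \<in> S" using img t by auto
    have "(\<Phi> has_derivative D (x t)) (at (x t) within x ` {0..T})"
      using has_derivative_subset[OF deriv[OF xt] img] .
    then have "(\<Phi> \<circ> x has_vector_derivative D (x t) (F (x t))) (at t within {0..T})"
      using vector_derivative_diff_chain_within sol t unfolding is_solution_def by blast
    then show ?thesis using push[OF xt] by simp
  qed
  have smono: "strict_mono_on {0..T} \<tau>0"
    using has_real_derivative_pos_imp_strict_mono_on[OF _ \<tau>0 pos'] by (simp add: is_interval_cc)
  have im\<tau>: "\<tau>0 ` {0..T} = {0..\<tau>0 T}"
    using strict_mono_on_image_atLeastAtMost[OF T _ smono] DERIV_continuous_on[OF \<tau>0]
    by (simp add: \<tau>0_def)
  obtain \<sigma> where hom: "homeomorphism {0..T} {0..\<tau>0 T} \<tau>0 \<sigma>"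
    and sol': "is_solution G {0..\<tau>0 T} ((\<Phi> \<circ> x) \<circ> \<sigma>)"
    using is_solution_time_change[OF _ \<gamma> \<tau>0 pos'] im\<tau> by (metis is_interval_cc)
  have "\<sigma> ` {0..\<tau>0 T} = {0..T}" and \<sigma>: "\<And>t. t \<in> {0..T} \<Longrightarrow> \<sigma> (\<tau>0 t) = t"
    using hom by (auto simp: homeomorphism_def)
  then have "((\<Phi> \<circ> x) \<circ> \<sigma>) ` {0..\<tau>0 T} \<subseteq> \<Phi> ` S"
    using img by (metis image_comp image_mono)
  moreover have "\<sigma> 0 = 0" "\<sigma> (\<tau>0 T) = T"
    using \<sigma>[of 0] \<sigma>[of T] T by (auto simp: \<tau>0_def)
  moreover have "\<tau>0 T \<ge> 0" using im\<tau> T by (metis atLeastAtMost_iff image_eqI order_refl)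
  ultimately show ?thesis
    unfolding flows_to_def using sol' x0 xT by (intro exI[of _ "\<tau>0 T"] conjI exI[of _ "(\<Phi> \<circ> x) \<circ> \<sigma>"]) auto
qed

text \<open>Invariance of domain supplies the open image and a continuous inverse; for a continuous
  inverse, pointwise invertibility of the derivative gives differentiability.\<close>

lemma diffeo_inverse:
  fixes \<Phi> :: "'a::euclidean_space \<Rightarrow> 'a"
  assumes "open O1" "inj_on \<Phi> O1"
    and deriv: "\<And>x. x \<in> O1 \<Longrightarrow> (\<Phi> has_derivative D x) (at x)"
    and inj: "\<And>x. x \<in> O1 \<Longrightarrow> inj (D x)"
  obtains \<Psi> E where "open (\<Phi> ` O1)" "homeomorphism O1 (\<Phi> ` O1) \<Phi> \<Psi>"
    "\<And>x. x \<in> O1 \<Longrightarrow> (\<Psi> has_derivative E x) (at (\<Phi> x))"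
    "\<And>x. x \<in> O1 \<Longrightarrow> linear (E x)" "\<And>x. x \<in> O1 \<Longrightarrow> E x \<circ> D x = id"
proof -
  have cont: "continuous_on O1 \<Phi>"
    using deriv by (meson continuous_at_imp_continuous_on has_derivative_continuous)
  have op: "open (\<Phi> ` O1)" using invariance_of_domain assms cont by blast
  obtain \<Psi> where hom: "homeomorphism O1 (\<Phi> ` O1) \<Phi> \<Psi>"
    using invariance_of_domain_homeomorphism assms cont by (metis order_refl)
  have \<Psi>: "\<Psi> (\<Phi> x) = x" if "x \<in> O1" for x using hom that by (simp add: homeomorphism_def)
  have cont\<Psi>: "continuous_on (\<Phi> ` O1) \<Psi>" using hom by (simp add: homeomorphism_def)
  have "\<exists>E. linear E \<and> E \<circ> D x = id" if "x \<in> O1" for x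
    using linear_injective_left_inverse[OF has_derivative_linear[OF deriv[OF that]] inj[OF that]] by blast
  then obtain E where E: "\<And>x. x \<in> O1 \<Longrightarrow> linear (E x)" "\<And>x. x \<in> O1 \<Longrightarrow> E x \<circ> D x = id"
    by metis
  have "(\<Psi> has_derivative E x) (at (\<Phi> x))" if "x \<in> O1" for x
    using has_derivative_inverse_dieudonne[OF \<open>open O1\<close> op cont cont\<Psi> \<Psi> that deriv[OF that]]
      E[OF that] linear_conv_bounded_linear by blast
  then show thesis using that op hom E by blast
qed

lemma flows_to_diffeo:
  assumes "open O1" "S \<subseteq> O1" "inj_on \<Phi> O1"
    and deriv: "\<And>x. x \<in> O1 \<Longrightarrow> (\<Phi> has_derivative D x) (at x)"
    and inj: "\<And>x. x \<in> O1 \<Longrightarrow> inj (D x)"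
    and push: "\<And>x. x \<in> O1 \<Longrightarrow> D x (F x) = \<kappa> x *\<^sub>R G (\<Phi> x)"
    and pos: "\<And>x. x \<in> O1 \<Longrightarrow> \<kappa> x > (0::real)"
    and cont: "continuous_on O1 \<kappa>"
    and q: "q \<in> S" and r: "r \<in> S"
  shows "flows_to F S q r \<longleftrightarrow> flows_to G (\<Phi> ` S) (\<Phi> q) (\<Phi> r)"
proof
  show "flows_to G (\<Phi> ` S) (\<Phi> q) (\<Phi> r)" if "flows_to F S q r"
    by (rule flows_to_push[of S \<Phi> D F \<kappa>, OF _ _ _ _ that])
      (use assms(2) deriv push pos continuous_on_subset[OF cont] in \<open>blast intro: has_derivative_at_withinI\<close>)+
next
  assume flow: "flows_to G (\<Phi> ` S) (\<Phi> q) (\<Phi> r)"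
  obtain \<Psi> E where "open (\<Phi> ` O1)" and hom: "homeomorphism O1 (\<Phi> ` O1) \<Phi> \<Psi>"
    and deriv\<Psi>: "\<And>x. x \<in> O1 \<Longrightarrow> (\<Psi> has_derivative E x) (at (\<Phi> x))"
    and E: "\<And>x. x \<in> O1 \<Longrightarrow> linear (E x)" "\<And>x. x \<in> O1 \<Longrightarrow> E x \<circ> D x = id"
    by (rule diffeo_inverse[OF assms(1,3) deriv inj]) (assumption | rule that)+
  have \<Psi>: "\<Psi> (\<Phi> x) = x" if "x \<in> O1" for x using hom that by (simp add: homeomorphism_def)
  have cont\<Psi>: "continuous_on (\<Phi> ` O1) \<Psi>" using hom by (simp add: homeomorphism_def)
  \<comment> \<open>The converse is the same push along the inverse chart with factor 1/\<kappa>,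
    since \<open>E\<close> undoes \<open>D\<close>.\<close>
  have "flows_to F (\<Psi> ` (\<Phi> ` S)) (\<Psi> (\<Phi> q)) (\<Psi> (\<Phi> r))"
  proof (rule flows_to_push[OF _ _ _ _ flow])
    fix z assume "z \<in> \<Phi> ` S"
    then obtain x where x: "x \<in> O1" "z = \<Phi> x" using assms(2) by blast
    then show "(\<Psi> has_derivative E (\<Psi> z)) (at z within \<Phi> ` S)"
      using deriv\<Psi>[OF x(1)] \<Psi>[OF x(1)] by (simp add: has_derivative_at_withinI)
    have "G z = inverse (\<kappa> x) *\<^sub>R D x (F x)"
      using push[OF x(1)] pos[OF x(1)] x by simp
    then have "E x (G z) = inverse (\<kappa> x) *\<^sub>R (E x \<circ> D x) (F x)"
      using E(1)[OF x(1)] by (simp add: linear_cmul)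
    then show "E (\<Psi> z) (G z) = inverse (\<kappa> (\<Psi> z)) *\<^sub>R F (\<Psi> z)"
      using E(2)[OF x(1)] x \<Psi>[OF x(1)] by simp
    show "inverse (\<kappa> (\<Psi> z)) > 0" using pos[OF x(1)] x \<Psi>[OF x(1)] by simp
  next
    have sub: "\<Psi> ` (\<Phi> ` S) \<subseteq> O1" using \<Psi> assms(2) by force
    have "continuous_on (\<Phi> ` S) \<Psi>" using cont\<Psi> assms(2) by (meson continuous_on_subset image_mono)
    then have "continuous_on (\<Phi> ` S) (\<lambda>z. \<kappa> (\<Psi> z))"
      using continuous_on_compose2[OF cont _ sub] by blast
    moreover have "\<kappa> (\<Psi> z) \<noteq> 0" if "z \<in> \<Phi> ` S" for z
      using sub pos that by (metis image_subset_iff less_irrefl)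
    ultimately show "continuous_on (\<Phi> ` S) (\<lambda>z. inverse (\<kappa> (\<Psi> z)))"
      by (intro continuous_on_inverse) blast+
  qed
  moreover have "\<Psi> ` (\<Phi> ` S) = S" using \<Psi> assms(2) by force
  moreover have "\<Psi> (\<Phi> q) = q" "\<Psi> (\<Phi> r) = r" using \<Psi> q r assms(2) by blast+
  ultimately show "flows_to F S q r" by simp
qed

section \<open>Flows near an equilibrium\<close>

lemma has_real_derivative_nonneg_imp_le:
  fixes f :: "real \<Rightarrow> real"
  assumes "a \<le> b" and "\<And>t. t \<in> {a..b} \<Longrightarrow> (f has_real_derivative f' t) (at t within {a..b})"
    and "\<And>t. t \<in> {a..b} \<Longrightarrow> f' t \<ge> 0"
  shows "f a \<le> f b"
proof -
  have "\<exists>x\<in>{a..b}. f b - f a = (*) (f' x) (b - a)"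
    by (rule mvt_very_simple[OF \<open>a \<le> b\<close>]) (use assms(2) in \<open>auto simp: has_field_derivative_def\<close>)
  then obtain x where "x \<in> {a..b}" "f b - f a = f' x * (b - a)" by auto
  then show ?thesis using assms by (smt (verit) mult_nonneg_nonneg)
qed

text \<open>The squared distance e to \<open>p\<close> satisfies |e'| \<le> 2 \<kappa> e, so e exp(2
  \<tau>) is nondecreasing and e exp(-2 \<tau>) is nonincreasing. The estimate holds in both
  directions of time and has two uses: a curve that is at \<open>p\<close> once is always there, and
  a curve that is elsewhere cannot come arbitrarily close to \<open>p\<close> while \<tau> stays
  bounded.\<close>

lemma gronwall_near_point:
  fixes x :: "real \<Rightarrow> 'a::real_inner"
  assumes I: "is_interval I" "s \<in> I" "t \<in> I"
    and x: "\<And>t. t \<in> I \<Longrightarrow> (x has_vector_derivative x' t) (at t within I)"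
    and \<tau>: "\<And>t. t \<in> I \<Longrightarrow> (\<tau> has_real_derivative \<kappa> t) (at t within I)"
    and pos: "\<And>t. t \<in> I \<Longrightarrow> \<kappa> t \<ge> 0"
    and bound: "\<And>t. t \<in> I \<Longrightarrow> norm (x' t) \<le> \<kappa> t * norm (x t - p)"
  shows "norm (x s - p) \<le> exp \<bar>\<tau> t - \<tau> s\<bar> * norm (x t - p)"
proof -
  define e where "e t = (x t - p) \<bullet> (x t - p)" for t
  define e' where "e' t = 2 * (x' t \<bullet> (x t - p))" for t
  have deriv_e: "(e has_real_derivative e' t) (at t within I)" if "t \<in> I" for t
    unfolding e_def e'_def has_field_derivative_def
    by (rule derivative_eq_intros x[OF that, unfolded has_vector_derivative_def] refl
        | simp add: fun_eq_iff inner_commute algebra_simps)+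
  have e': "\<bar>e' t\<bar> \<le> 2 * \<kappa> t * e t" if "t \<in> I" for t
  proof -
    have "\<bar>x' t \<bullet> (x t - p)\<bar> \<le> norm (x' t) * norm (x t - p)" by (rule Cauchy_Schwarz_ineq2)
    also have "\<dots> \<le> \<kappa> t * norm (x t - p) * norm (x t - p)"
      by (intro mult_right_mono bound that) simp
    also have "\<dots> = \<kappa> t * e t"
      by (simp add: e_def power2_norm_eq_inner flip: power2_eq_square)
    finally show ?thesis by (simp add: e'_def)
  qed
  have main: "e a \<le> exp (2 * (\<tau> b - \<tau> a)) * e b \<and> e b \<le> exp (2 * (\<tau> b - \<tau> a)) * e a \<and> \<tau> a \<le> \<tau> b"
    if ab: "a \<in> I" "b \<in> I" "a \<le> b" for a b
  proof -
    have sub: "{a..b} \<subseteq> I" using I(1) ab by (meson atLeastAtMost_iff mem_is_interval_1_I subsetI)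
    have d\<tau>: "(\<tau> has_real_derivative \<kappa> t) (at t within {a..b})"
      and de: "(e has_real_derivative e' t) (at t within {a..b})" if "t \<in> {a..b}" for t
      using DERIV_subset[OF \<tau> sub] DERIV_subset[OF deriv_e sub] sub that by blast+
    have "\<tau> a \<le> \<tau> b"
      by (rule has_real_derivative_nonneg_imp_le[OF \<open>a \<le> b\<close> d\<tau>]) (use pos sub in auto)
    moreover have "exp (2 * \<tau> a) * e a \<le> exp (2 * \<tau> b) * e b"
    proof (rule has_real_derivative_nonneg_imp_le[OF \<open>a \<le> b\<close>])
      fix t assume t: "t \<in> {a..b}"
      show "((\<lambda>t. exp (2 * \<tau> t) * e t) has_real_derivative exp (2 * \<tau> t) * (2 * \<kappa> t * e t + e' t)) (at t within {a..b})"
        by (rule derivative_eq_intros d\<tau>[OF t] de[OF t] refl | simp add: algebra_simps)+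
      show "0 \<le> exp (2 * \<tau> t) * (2 * \<kappa> t * e t + e' t)"
        using e'[of t] t sub by (intro mult_nonneg_nonneg) auto
    qed
    moreover have "- (exp (- (2 * \<tau> a)) * e a) \<le> - (exp (- (2 * \<tau> b)) * e b)"
    proof (rule has_real_derivative_nonneg_imp_le[OF \<open>a \<le> b\<close>])
      fix t assume t: "t \<in> {a..b}"
      show "((\<lambda>t. - (exp (- (2 * \<tau> t)) * e t)) has_real_derivative exp (- (2 * \<tau> t)) * (2 * \<kappa> t * e t - e' t)) (at t within {a..b})"
        by (rule derivative_eq_intros d\<tau>[OF t] de[OF t] refl | simp add: algebra_simps)+
      show "0 \<le> exp (- (2 * \<tau> t)) * (2 * \<kappa> t * e t - e' t)"
        using e'[of t] t sub by (intro mult_nonneg_nonneg) auto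
    qed
    ultimately show ?thesis
      by (simp add: exp_diff exp_minus field_simps right_diff_distrib)
  qed
  have "e s \<le> exp (2 * \<bar>\<tau> t - \<tau> s\<bar>) * e t"
    using main[of s t] main[of t s] I by (cases "s \<le> t") auto
  then have "(norm (x s - p))\<^sup>2 \<le> (exp \<bar>\<tau> t - \<tau> s\<bar> * norm (x t - p))\<^sup>2"
    by (simp add: e_def power2_norm_eq_inner power_mult_distrib exp_double)
  then show ?thesis by (rule power2_le_imp_le) simp
qed

lemma flows_to_refl_equilibrium:
  assumes "F p = 0" "p \<in> S"
  shows "flows_to F S p p"
proof -
  have "is_solution F {0..0} (\<lambda>_. p)"
    unfolding is_solution_def using assms(1) has_vector_derivative_const by metis
  moreover have "(\<lambda>_. p) ` {0..0::real} \<subseteq> S" using assms(2) by (simp add: image_subset_iff)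
  ultimately show ?thesis unfolding flows_to_def by (metis order_refl)
qed

text \<open>By Gronwall with the clock |K| t, a solution that meets \<open>p\<close> is constant. So
  \<open>p\<close> is an orbit by itself and every other orbit arc in \<open>S\<close> avoids
  it.\<close>

lemma flows_to_equilibrium_iff:
  assumes bound: "\<And>x. x \<in> S \<Longrightarrow> norm (F x) \<le> K * norm (x - p)" and p: "p \<in> S"
  shows "flows_to F S q r \<longleftrightarrow> q = p \<and> r = p \<or> flows_to F (S - {p}) q r"
proof
  assume "flows_to F S q r"
  then obtain T x where T: "T \<ge> 0" and sol: "is_solution F {0..T} x" and img: "x ` {0..T} \<subseteq> S"
    and x0: "x 0 = q" and xT: "x T = r"
    unfolding flows_to_def by blast
  show "q = p \<and> r = p \<or> flows_to F (S - {p}) q r"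
  proof (cases "\<exists>t\<in>{0..T}. x t = p")
    case True
    then obtain t where t: "t \<in> {0..T}" "x t = p" by blast
    have "norm (x s - p) \<le> exp \<bar>\<bar>K\<bar> * t - \<bar>K\<bar> * s\<bar> * norm (x t - p)" if "s \<in> {0..T}" for s
    proof (rule gronwall_near_point[OF is_interval_cc that t(1)])
      fix t assume t: "t \<in> {0..T}"
      show "(x has_vector_derivative F (x t)) (at t within {0..T})"
        using sol t by (simp add: is_solution_def)
      show "((*) \<bar>K\<bar> has_real_derivative \<bar>K\<bar>) (at t within {0..T})"
        by (rule derivative_eq_intros refl | simp)+
      have "norm (F (x t)) \<le> K * norm (x t - p)" using bound img t by blast
      also have "\<dots> \<le> \<bar>K\<bar> * norm (x t - p)" by (intro mult_right_mono) auto
      finally show "norm (F (x t)) \<le> \<bar>K\<bar> * norm (x t - p)" .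
    qed simp
    then have "x s = p" if "s \<in> {0..T}" for s using t that by simp
    then show ?thesis using x0 xT T by auto
  next
    case False
    then have "x ` {0..T} \<subseteq> S - {p}" using img by blast
    then show ?thesis unfolding flows_to_def using T sol x0 xT by blast
  qed
next
  have "F p = 0" using bound[OF p] by simp
  moreover have "flows_to F S q r" if "flows_to F (S - {p}) q r"
    using that unfolding flows_to_def by blast
  ultimately show "q = p \<and> r = p \<or> flows_to F (S - {p}) q r \<Longrightarrow> flows_to F S q r"
    using flows_to_refl_equilibrium p by metis
qed

lemma flows_to_endpoints:
  assumes "flows_to F S q r"
  shows "q \<in> S \<and> r \<in> S"
proof -
  obtain T x where T: "T \<ge> 0" and "is_solution F {0..T} x" and img: "x ` {0..T} \<subseteq> S"
    and x0: "x 0 = q" and xT: "x T = r"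
    using assms unfolding flows_to_def by blast
  have "x 0 \<in> x ` {0..T}" "x T \<in> x ` {0..T}" using T by simp_all
  then show ?thesis using img x0 xT by blast
qed

text \<open>Meant for the vertex of a hyperbolic sector, where the charts in use have a singular
  derivative. The linear bounds make the vertex a separate orbit for both fields, so an equivalence
  away from it extends.\<close>

lemma orbit_equivalence_puncture:
  assumes hom: "homeomorphism S R h k" and p: "p \<in> S"
    and F: "\<And>x. x \<in> S \<Longrightarrow> norm (F x) \<le> K * norm (x - p)"
    and G: "\<And>x. x \<in> R \<Longrightarrow> norm (G x) \<le> L * norm (x - h p)"
    and flow: "\<And>q r. q \<in> S - {p} \<Longrightarrow> r \<in> S - {p} \<Longrightarrow>
      flows_to F (S - {p}) q r \<longleftrightarrow> flows_to G (R - {h p}) (h q) (h r)"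
  shows "orbit_equivalence F S G R h"
proof -
  have hp: "h p \<in> R" and inj: "\<And>q. q \<in> S \<Longrightarrow> h q = h p \<longleftrightarrow> q = p"
    using hom p by (metis homeomorphism_def imageI)+
  have "flows_to F S q r \<longleftrightarrow> flows_to G R (h q) (h r)" if "q \<in> S" "r \<in> S" for q r
  proof -
    have "flows_to F (S - {p}) q r \<longleftrightarrow> flows_to G (R - {h p}) (h q) (h r)"
    proof (cases "q = p \<or> r = p")
      case True
      then show ?thesis using flows_to_endpoints[of F "S - {p}" q r]
          flows_to_endpoints[of G "R - {h p}" "h q" "h r"] by blast
    next
      case False
      then show ?thesis using flow that by simp
    qed
    moreover have "q = p \<and> r = p \<longleftrightarrow> h q = h p \<and> h r = h p"
      using inj that by simp
    moreover have "flows_to F S q r \<longleftrightarrow> q = p \<and> r = p \<or> flows_to F (S - {p}) q r"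
      by (rule flows_to_equilibrium_iff[OF F p])
    moreover have "flows_to G R (h q) (h r) \<longleftrightarrow> h q = h p \<and> h r = h p \<or> flows_to G (R - {h p}) (h q) (h r)"
      by (rule flows_to_equilibrium_iff[OF G hp])
    ultimately show ?thesis by argo
  qed
  then show ?thesis unfolding orbit_equivalence_def using hom by blast
qed

section \<open>Centers\<close>

definition rotation_field :: "real \<times> real \<Rightarrow> real \<times> real"
  where "rotation_field = (\<lambda>(a, b). (b, - a))"

lemma has_real_antiderivative_UNIV:
  fixes f :: "real \<Rightarrow> real"
  assumes "continuous_on UNIV f"
  obtains \<tau> where "\<And>t. (\<tau> has_real_derivative f t) (at t)"
proof -
  have "\<And>x. isCont f x" using assms by (simp add: continuous_on_eq_continuous_at)
  then obtain \<tau> where "\<forall>x. - \<infinity> < ereal x \<longrightarrow> ereal x < \<infinity> \<longrightarrow> (\<tau> has_vector_derivative f x) (at x)"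
    using einterval_antiderivative[of "- \<infinity>" \<infinity> f] by (metis MInfty_neq_PInfty(1) ereal_infty_less(2))
  then show thesis using that[of \<tau>] by (simp add: has_real_derivative_iff_has_vector_derivative)
qed

lemma circle_param:
  assumes "\<rho> > 0" "norm z = \<rho>"
  obtains t where "z = (\<rho> * sin t, \<rho> * cos t)"
proof -
  obtain a b where z: "z = (a, b)" by (cases z)
  have "a\<^sup>2 + b\<^sup>2 = \<rho>\<^sup>2"
    using assms z by (metis norm_Pair norm_ge_zero real_norm_def real_sqrt_pow2 power2_abs sum_power2_ge_zero)
  then have "(b / \<rho>)\<^sup>2 + (a / \<rho>)\<^sup>2 = 1" using assms by (simp add: power_divide field_simps)
  then obtain t where "b / \<rho> = cos t" "a / \<rho> = sin t" using sincos_total_2pi by metis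
  then show thesis using that[of t] z assms by (simp add: field_simps)
qed

lemma norm_circle: "\<rho> \<ge> 0 \<Longrightarrow> norm (\<rho> * sin t, \<rho> * cos t) = (\<rho>::real)"
proof -
  assume "\<rho> \<ge> 0"
  have "(\<rho> * sin t)\<^sup>2 + (\<rho> * cos t)\<^sup>2 = \<rho>\<^sup>2 * ((sin t)\<^sup>2 + (cos t)\<^sup>2)"
    by (simp only: power_mult_distrib distrib_left)
  then show ?thesis using \<open>\<rho> \<ge> 0\<close> by (simp add: norm_Pair)
qed

text \<open>As \<kappa> has period 2 pi, every turn takes the same time \<open>T\<close> in the new
  clock \<tau>. Hence \<tau> is onto the real line, and the reparametrised loop is a solution for
  all times with period \<open>T\<close>.\<close>

lemma periodic_orbit_circle:
  assumes "\<rho> > 0"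
    and deriv: "\<And>t. (\<gamma> has_vector_derivative \<kappa> t *\<^sub>R F (\<gamma> t)) (at t)"
    and pos: "\<And>t. \<kappa> t > (0::real)" and cont: "continuous_on UNIV \<kappa>"
    and per: "\<And>t. \<gamma> (t + 2 * pi) = \<gamma> t" "\<And>t. \<kappa> (t + 2 * pi) = \<kappa> t"
    and nonconst: "\<gamma> a \<noteq> \<gamma> b"
  shows "periodic_orbit F (range \<gamma>)"
proof -
  obtain \<tau> where \<tau>: "\<And>t. (\<tau> has_real_derivative \<kappa> t) (at t)"
    using has_real_antiderivative_UNIV[OF cont] by blast
  have mono: "strict_mono_on UNIV \<tau>"
    by (rule has_real_derivative_pos_imp_strict_mono_on[of _ _ \<kappa>]) (use \<tau> pos in auto)
  define T where "T = \<tau> (2 * pi) - \<tau> 0"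
  have "T > 0" using strict_mono_onD[OF mono, of 0 "2 * pi"] by (simp add: T_def)
  have "((\<lambda>t. \<tau> (t + 2 * pi) - \<tau> t) has_real_derivative 0) (at t)" for t
  proof -
    have "((\<lambda>t. \<tau> (t + 2 * pi)) has_real_derivative \<kappa> (t + 2 * pi)) (at t)"
      using \<tau>[of "t + 2 * pi"] by (simp add: DERIV_shift)
    from DERIV_diff[OF this \<tau>[of t]] show ?thesis by (simp add: per)
  qed
  then have "\<forall>t. ((\<lambda>t. \<tau> (t + 2 * pi) - \<tau> t) has_real_derivative 0) (at t)" by blast
  then have "\<tau> (t + 2 * pi) - \<tau> t = \<tau> (0 + 2 * pi) - \<tau> 0" for t
    using DERIV_isconst_all[of "\<lambda>t. \<tau> (t + 2 * pi) - \<tau> t" t 0] by simp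
  then have \<tau>per: "\<tau> (t + 2 * pi) = \<tau> t + T" for t
    unfolding T_def by (smt (verit))
  have \<tau>n: "\<tau> (t + real n * (2 * pi)) = \<tau> t + real n * T" for t n
  proof (induction n)
    case (Suc n)
    have "\<tau> (t + real (Suc n) * (2 * pi)) = \<tau> ((t + real n * (2 * pi)) + 2 * pi)"
      by (simp add: algebra_simps)
    also have "\<dots> = \<tau> t + real n * T + T" using \<tau>per Suc by metis
    finally show ?case by (simp add: algebra_simps)
  qed simp
  have surj: "\<exists>t. \<tau> t = s" for s
  proof -
    obtain n where n: "\<bar>s - \<tau> 0\<bar> < real n * T" using reals_Archimedean3[OF \<open>T > 0\<close>] by blast
    have "\<tau> (real n * (2 * pi)) = \<tau> 0 + real n * T" using \<tau>n[of 0 n] by simp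
    moreover have "\<tau> (- (real n * (2 * pi))) = \<tau> 0 - real n * T" using \<tau>n[of "- (real n * (2 * pi))" n] by simp
    moreover have "- (real n * (2 * pi)) \<le> real n * (2 * pi)" by (simp add: pi_ge_zero)
    moreover have "continuous_on {- (real n * (2 * pi))..real n * (2 * pi)} \<tau>"
      using \<tau> by (meson DERIV_continuous_on DERIV_subset subset_UNIV)
    moreover have "\<tau> 0 - real n * T \<le> s" "s \<le> \<tau> 0 + real n * T" using n by linarith+
    ultimately show ?thesis using IVT'[of \<tau> "- (real n * (2 * pi))" s "real n * (2 * pi)"] by auto
  qed
  then have range: "range \<tau> = UNIV" by (metis UNIV_eq_I rangeI)
  obtain \<sigma> where hom: "homeomorphism UNIV (range \<tau>) \<tau> \<sigma>" and sol: "is_solution F (range \<tau>) (\<gamma> \<circ> \<sigma>)"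
    by (rule is_solution_time_change[of UNIV \<gamma> \<kappa> F \<tau>]) (use deriv \<tau> pos in auto)
  have \<sigma>: "\<sigma> (\<tau> t) = t" "\<tau> (\<sigma> t) = t" for t
    using hom range by (simp_all add: homeomorphism_def)
  have "(\<gamma> \<circ> \<sigma>) (t + T) = (\<gamma> \<circ> \<sigma>) t" for t
  proof -
    have "\<sigma> (t + T) = \<sigma> t + 2 * pi" using \<tau>per[of "\<sigma> t"] \<sigma> by metis
    then show ?thesis by (simp add: per)
  qed
  moreover have "range (\<gamma> \<circ> \<sigma>) = range \<gamma>" using \<sigma>(1) by (metis image_comp surj_def)
  moreover have "\<exists>t. (\<gamma> \<circ> \<sigma>) t \<noteq> (\<gamma> \<circ> \<sigma>) 0" using nonconst \<sigma>(1) by (metis comp_apply)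
  ultimately show ?thesis unfolding periodic_orbit_def using sol range \<open>T > 0\<close> by metis
qed

text \<open>The frontier of the preimage of the open ball lies on the curve. The component of
  \<open>p\<close> in the complement of the curve therefore stays in that preimage, which is bounded
  since it lies in the compact image of the closed ball.\<close>

lemma inside_preimage_sphere:
  fixes \<Phi> :: "'a::euclidean_space \<Rightarrow> 'a"
  assumes hom: "homeomorphism O1 (\<Phi> ` O1) \<Phi> \<Psi>" and op: "open O1"
    and p: "p \<in> O1" "\<Phi> p = 0" and \<rho>: "\<rho> > 0" "cball 0 \<rho> \<subseteq> \<Phi> ` O1"
  shows "p \<in> inside (\<Psi> ` sphere 0 \<rho>)"
proof -
  let ?C = "\<Psi> ` sphere 0 \<rho>" and ?D = "O1 \<inter> \<Phi> -` ball 0 \<rho>"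
  have \<Psi>\<Phi>: "\<Psi> (\<Phi> x) = x" if "x \<in> O1" for x using hom that by (simp add: homeomorphism_def)
  have \<Phi>\<Psi>: "\<Phi> (\<Psi> z) = z" if "z \<in> \<Phi> ` O1" for z using homeomorphism_apply2[OF hom that] .
  have cont\<Phi>: "continuous_on O1 \<Phi>" and cont\<Psi>: "continuous_on (\<Phi> ` O1) \<Psi>"
    using hom by (simp_all add: homeomorphism_def)
  have opD: "open ?D" by (rule continuous_open_preimage[OF cont\<Phi> op open_ball])
  have cpt: "compact (\<Psi> ` cball 0 \<rho>)"
    using compact_continuous_image[OF continuous_on_subset[OF cont\<Psi> \<rho>(2)]] by simp
  have D_sub: "?D \<subseteq> \<Psi> ` cball 0 \<rho>"
  proof
    fix x assume x: "x \<in> ?D"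
    then have "x = \<Psi> (\<Phi> x)" "\<Phi> x \<in> cball 0 \<rho>" using \<Psi>\<Phi> by auto
    then show "x \<in> \<Psi> ` cball 0 \<rho>" by blast
  qed
  have "closure ?D \<subseteq> \<Psi> ` cball 0 \<rho>" using D_sub cpt by (simp add: closure_minimal compact_imp_closed)
  moreover have "\<Psi> z \<in> ?D \<or> \<Psi> z \<in> ?C" if "z \<in> cball 0 \<rho>" for z
  proof (cases "norm z < \<rho>")
    case True
    have "z \<in> \<Phi> ` O1" using that \<rho> by blast
    then have "\<Psi> z \<in> O1" "\<Phi> (\<Psi> z) = z" using \<Psi>\<Phi> \<Phi>\<Psi> by force+
    then show ?thesis using True by simp
  next
    case False
    then have "z \<in> sphere 0 \<rho>" using that by simp
    then show ?thesis by blast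
  qed
  ultimately have front: "frontier ?D \<subseteq> ?C"
    unfolding frontier_def interior_open[OF opD] by blast
  have pC: "p \<notin> ?C"
  proof
    assume "p \<in> ?C"
    then obtain z where z: "z \<in> sphere 0 \<rho>" "p = \<Psi> z" by blast
    then have "z \<in> \<Phi> ` O1" using \<rho> by auto
    then have "z = 0" using \<Phi>\<Psi> z p by metis
    then show False using z \<rho> by simp
  qed
  let ?K = "connected_component_set (- ?C) p"
  have "?K \<inter> frontier ?D = {}" using front connected_component_subset by fast
  moreover have "p \<in> ?K \<inter> ?D" using p \<rho> pC by (simp add: connected_component_refl)
  ultimately have "?K \<subseteq> ?D" using connected_Int_frontier[of ?K ?D] by (metis connected_connected_component Diff_eq_empty_iff empty_iff)
  then have "bounded ?K" using D_sub cpt bounded_subset compact_imp_bounded by (metis order_trans)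
  then show ?thesis using pC by (simp add: inside_def)
qed

lemma is_center_rotation:
  assumes "open O1" "inj_on \<Phi> O1" and p: "p \<in> O1" "\<Phi> p = 0"
    and deriv: "\<And>x. x \<in> O1 \<Longrightarrow> (\<Phi> has_derivative D x) (at x)"
    and inj: "\<And>x. x \<in> O1 \<Longrightarrow> inj (D x)"
    and push: "\<And>x. x \<in> O1 \<Longrightarrow> D x (F x) = \<kappa> x *\<^sub>R rotation_field (\<Phi> x)"
    and pos: "\<And>x. x \<in> O1 \<Longrightarrow> \<kappa> x > (0::real)"
    and cont: "continuous_on O1 \<kappa>"
  shows "is_center F p"
proof -
  obtain \<Psi> E where op\<Phi>: "open (\<Phi> ` O1)" and hom: "homeomorphism O1 (\<Phi> ` O1) \<Phi> \<Psi>"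
    and deriv\<Psi>: "\<And>x. x \<in> O1 \<Longrightarrow> (\<Psi> has_derivative E x) (at (\<Phi> x))"
    and E: "\<And>x. x \<in> O1 \<Longrightarrow> linear (E x)" "\<And>x. x \<in> O1 \<Longrightarrow> E x \<circ> D x = id"
    by (rule diffeo_inverse[OF assms(1,2) deriv inj]) (assumption | rule that)+
  have \<Psi>\<Phi>: "\<Psi> (\<Phi> x) = x" if "x \<in> O1" for x using hom that by (simp add: homeomorphism_def)
  have \<Phi>\<Psi>: "\<Phi> (\<Psi> z) = z" "\<Psi> z \<in> O1" if "z \<in> \<Phi> ` O1" for z
    using hom that by (auto simp: homeomorphism_def)
  have cont\<Phi>: "continuous_on O1 \<Phi>" using hom by (simp add: homeomorphism_def)
  have "D p (F p) = 0" using push[OF p(1)] p by (simp add: rotation_field_def zero_prod_def)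
  then have Fp: "F p = 0"
    using inj[OF p(1)] linear_0[OF has_derivative_linear[OF deriv[OF p(1)]]] by (metis injD)
  have E_push: "E x (rotation_field (\<Phi> x)) = inverse (\<kappa> x) *\<^sub>R F x" if "x \<in> O1" for x
  proof -
    have "rotation_field (\<Phi> x) = inverse (\<kappa> x) *\<^sub>R D x (F x)"
      using push[OF that] pos[OF that] by simp
    then have "E x (rotation_field (\<Phi> x)) = inverse (\<kappa> x) *\<^sub>R (E x \<circ> D x) (F x)"
      using E(1)[OF that] by (simp add: linear_cmul)
    then show ?thesis using E(2)[OF that] by simp
  qed
  have "0 \<in> \<Phi> ` O1" using p by (metis imageI)
  then obtain \<epsilon> where \<epsilon>: "\<epsilon> > 0" "ball 0 \<epsilon> \<subseteq> \<Phi> ` O1" using op\<Phi> open_contains_ball by metis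
  \<comment> \<open>The preimage of a ball contains, with each of its points, the whole closed orbit
    through that point.\<close>
  let ?U = "O1 \<inter> \<Phi> -` ball 0 \<epsilon>"
  have "open ?U" by (rule continuous_open_preimage[OF cont\<Phi> assms(1) open_ball])
  moreover have "p \<in> ?U" using p \<epsilon> by simp
  moreover have "\<exists>C. periodic_orbit F C \<and> q \<in> C \<and> C \<subseteq> ?U \<and> p \<in> inside C" if q: "q \<in> ?U - {p}" for q
  proof -
    define \<rho> where "\<rho> = norm (\<Phi> q)"
    have "\<Phi> q \<noteq> 0" using q p \<Psi>\<Phi> by (metis DiffD1 DiffD2 IntD1 singletonI)
    then have \<rho>: "\<rho> > 0" "\<rho> < \<epsilon>" using q by (auto simp: \<rho>_def)
    have cball: "cball 0 \<rho> \<subseteq> \<Phi> ` O1" using \<rho> \<epsilon>(2) by (force simp: subset_iff)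
    \<comment> \<open>An explicit orbit of \<open>rotation_field\<close>; by \<open>E_push\<close>
      its preimage follows \<open>F\<close> with speed factor 1/\<kappa>.\<close>
    define c where "c t = (\<rho> * sin t, \<rho> * cos t)" for t
    have c_norm: "norm (c t) = \<rho>" for t unfolding c_def using norm_circle \<rho> by simp
    have c_in: "c t \<in> \<Phi> ` O1" for t using c_norm cball by (metis dist_0_norm mem_cball order_refl subsetD)
    have "range c = sphere 0 \<rho>"
    proof (intro equalityI subsetI)
      fix z :: "real \<times> real" assume "z \<in> sphere 0 \<rho>"
      then show "z \<in> range c" using circle_param[OF \<rho>(1), of z] unfolding c_def by auto
    qed (use c_norm in auto)
    then have range: "range (\<Psi> \<circ> c) = \<Psi> ` sphere 0 \<rho>" by (metis image_comp)
    have c_deriv: "(c has_vector_derivative rotation_field (c t)) (at t)" for t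
      unfolding c_def rotation_field_def
      by (auto intro!: has_vector_derivative_Pair derivative_eq_intros
          simp: has_real_derivative_iff_has_vector_derivative[symmetric])
    have "periodic_orbit F (range (\<Psi> \<circ> c))"
    proof (rule periodic_orbit_circle[OF \<rho>(1), of _ "\<lambda>t. inverse (\<kappa> (\<Psi> (c t)))"])
      fix t
      have 1: "(\<Psi> has_derivative E (\<Psi> (c t))) (at (c t))"
        using deriv\<Psi>[OF \<Phi>\<Psi>(2)[OF c_in]] \<Phi>\<Psi>(1)[OF c_in] by metis
      have "(\<Psi> \<circ> c has_vector_derivative E (\<Psi> (c t)) (rotation_field (c t))) (at t)"
        using vector_derivative_diff_chain_within[OF c_deriv has_derivative_at_withinI[OF 1]] .
      then show "(\<Psi> \<circ> c has_vector_derivative inverse (\<kappa> (\<Psi> (c t))) *\<^sub>R F ((\<Psi> \<circ> c) t)) (at t)"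
        using E_push[OF \<Phi>\<Psi>(2)[OF c_in]] \<Phi>\<Psi>(1)[OF c_in] by simp
      show "inverse (\<kappa> (\<Psi> (c t))) > 0" using pos[OF \<Phi>\<Psi>(2)[OF c_in]] by simp
      show "(\<Psi> \<circ> c) (t + 2 * pi) = (\<Psi> \<circ> c) t" by (simp add: c_def)
      show "inverse (\<kappa> (\<Psi> (c (t + 2 * pi)))) = inverse (\<kappa> (\<Psi> (c t)))" by (simp add: c_def)
    next
      have "continuous_on UNIV c" unfolding c_def by (intro continuous_intros)
      then have "continuous_on UNIV (\<lambda>t. \<Psi> (c t))"
        using continuous_on_compose2[of "\<Phi> ` O1" \<Psi> UNIV c] hom c_in by (auto simp: homeomorphism_def)
      then have "continuous_on UNIV (\<lambda>t. \<kappa> (\<Psi> (c t)))"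
        using continuous_on_compose2[OF cont] \<Phi>\<Psi>(2)[OF c_in] by blast
      then show "continuous_on UNIV (\<lambda>t. inverse (\<kappa> (\<Psi> (c t))))"
        using pos[OF \<Phi>\<Psi>(2)[OF c_in]] by (intro continuous_on_inverse) (auto simp: less_le)
      have "c 0 \<noteq> c pi" using \<rho> by (simp add: c_def)
      then show "(\<Psi> \<circ> c) 0 \<noteq> (\<Psi> \<circ> c) pi" using \<Phi>\<Psi>(1)[OF c_in] by (metis comp_apply)
    qed
    moreover have "q \<in> \<Psi> ` sphere 0 \<rho>"
      using q \<Psi>\<Phi>[of q] by (auto simp: \<rho>_def intro!: image_eqI[of _ _ "\<Phi> q"])
    moreover have "\<Psi> ` sphere 0 \<rho> \<subseteq> ?U"
    proof
      fix x assume "x \<in> \<Psi> ` sphere 0 \<rho>"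
      then obtain z where z: "x = \<Psi> z" "norm z = \<rho>" by auto
      then have "z \<in> \<Phi> ` O1" using cball by (metis dist_0_norm mem_cball order_refl subsetD)
      then show "x \<in> ?U" using \<Phi>\<Psi> z \<rho> by simp
    qed
    moreover have "p \<in> inside (\<Psi> ` sphere 0 \<rho>)"
      by (rule inside_preimage_sphere[OF hom assms(1) p \<rho>(1) cball])
    ultimately show ?thesis unfolding range by blast
  qed
  ultimately show ?thesis unfolding is_center_def equilibria_def using Fp by blast
qed

section \<open>Nondegenerate equilibria of the planar field\<close>

lemma orbit_equivalence_linear_saddle:
  assumes "open O1" "inj_on \<Phi> O1" and p: "p \<in> O1" "\<Phi> p = 0"
    and deriv: "\<And>x. x \<in> O1 \<Longrightarrow> (\<Phi> has_derivative D x) (at x)"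
    and inj: "\<And>x. x \<in> O1 \<Longrightarrow> inj (D x)"
    and push: "\<And>x. x \<in> O1 \<Longrightarrow> D x (F x) = \<kappa> x *\<^sub>R linear_saddle (\<Phi> x)"
    and pos: "\<And>x. x \<in> O1 \<Longrightarrow> \<kappa> x > (0::real)"
    and cont: "continuous_on O1 \<kappa>"
  shows "\<exists>U V h. open U \<and> p \<in> U \<and> open V \<and> 0 \<in> V \<and> h p = 0 \<and>
    orbit_equivalence F U linear_saddle V h"
proof -
  obtain \<Psi> E where op: "open (\<Phi> ` O1)" and hom: "homeomorphism O1 (\<Phi> ` O1) \<Phi> \<Psi>"
    and "\<And>x. x \<in> O1 \<Longrightarrow> (\<Psi> has_derivative E x) (at (\<Phi> x))"
    and "\<And>x. x \<in> O1 \<Longrightarrow> linear (E x)" "\<And>x. x \<in> O1 \<Longrightarrow> E x \<circ> D x = id"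
    by (rule diffeo_inverse[OF assms(1,2) deriv inj]) (assumption | rule that)+
  have "0 \<in> \<Phi> ` O1" using p by (metis imageI)
  moreover have "flows_to F O1 q r \<longleftrightarrow> flows_to linear_saddle (\<Phi> ` O1) (\<Phi> q) (\<Phi> r)"
    if "q \<in> O1" "r \<in> O1" for q r
    by (rule flows_to_diffeo[of O1 O1 \<Phi> D F \<kappa>]) (use assms that in auto)
  then have "orbit_equivalence F O1 linear_saddle (\<Phi> ` O1) \<Phi>"
    unfolding orbit_equivalence_def using hom by blast
  ultimately show ?thesis using assms(1) op p by blast
qed

text \<open>The function s is a signed square root of \<eta> Q, and differentiating s^2 = \<eta> Q
  with Q' = 2 g / \<phi>^3 gives the last equation. The sign condition on \<eta> says that the
  factor \<open>R\<close> under the root is positive at \<open>u\<close>. The sign of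
  \<open>u\<close> is built into s so that s' \<phi>^3 is positive in both half planes and can serve
  as a time factor.\<close>

lemma energy_chart:
  fixes \<alpha>\<^sub>1 \<alpha>\<^sub>2 \<alpha>\<^sub>3 \<eta> u :: real
  assumes u: "u \<noteq> 0" and root: "\<alpha>\<^sub>1 * u ^ 6 + \<alpha>\<^sub>2 * u ^ 4 + \<alpha>\<^sub>3 = 0"
    and \<eta>: "\<eta>\<^sup>2 = 1" "\<eta> * (3 * \<alpha>\<^sub>1 * u\<^sup>2 + 2 * \<alpha>\<^sub>2) > 0"
  obtains J s s' where "open J" "is_interval J" "u \<in> J" "s u = 0"
    "\<And>\<phi>. \<phi> \<in> J \<Longrightarrow> (s has_real_derivative s' \<phi>) (at \<phi>)" "continuous_on J s'"
    "\<And>\<phi>. \<phi> \<in> J \<Longrightarrow> s' \<phi> * \<phi> ^ 3 > 0"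
    "\<And>\<phi>. \<phi> \<in> J \<Longrightarrow> \<alpha>\<^sub>1 * \<phi> ^ 6 + \<alpha>\<^sub>2 * \<phi> ^ 4 + \<alpha>\<^sub>3 = \<eta> * s \<phi> * (s' \<phi> * \<phi> ^ 3)"
proof -
  define R where "R \<phi> = \<eta> * (\<alpha>\<^sub>1 * (\<phi>\<^sup>2 / 2 + u\<^sup>2) + \<alpha>\<^sub>2)" for \<phi>
  define q where "q \<phi> = sqrt (R \<phi>)" for \<phi>
  define s where "s \<phi> = sgn u * ((\<phi>\<^sup>2 - u\<^sup>2) * q \<phi> / \<phi>)" for \<phi>
  define s' where "s' \<phi> = sgn u *
    (((2 * \<phi> * q \<phi> + (\<phi>\<^sup>2 - u\<^sup>2) * (\<eta> * \<alpha>\<^sub>1 * \<phi> / (2 * q \<phi>))) * \<phi> - (\<phi>\<^sup>2 - u\<^sup>2) * q \<phi>) / \<phi>\<^sup>2)" for \<phi>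
  define W where "W = (- {0}) \<inter> R -` {0<..}"
  have "continuous_on (- {0}) R" unfolding R_def by (intro continuous_intros) auto
  then have opW: "open W" unfolding W_def by (intro continuous_open_preimage) auto
  have W: "\<phi> \<noteq> 0" "R \<phi> > 0" if "\<phi> \<in> W" for \<phi> using that by (auto simp: W_def)
  have cR: "continuous_on W R" unfolding R_def by (intro continuous_intros) auto
  have cont: "continuous_on W s'"
    unfolding s'_def q_def using W by (intro continuous_intros cR) (auto simp: less_le)
  \<comment> \<open>This set is open and contains \<open>u\<close>; a ball inside it keeps the time
    factor positive and is an interval.\<close>
  define W' where "W' = W \<inter> (\<lambda>\<phi>. s' \<phi> * \<phi> ^ 3) -` {0<..}"
  have opW': "open W'" unfolding W'_def
    by (intro continuous_open_preimage opW open_greaterThan continuous_intros cont)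
  have Ru: "R u > 0" using \<eta>(2) by (simp add: R_def field_simps)
  then have uW: "u \<in> W" using u by (simp add: W_def)
  have "s' u * u ^ 3 = 2 * sqrt (R u) * (sgn u * u) * u\<^sup>2"
    using u by (simp add: s'_def q_def power2_eq_square power3_eq_cube)
  also have "\<dots> > 0" using Ru u by (simp add: sgn_mult_abs abs_sgn mult_pos_pos linordered_idom_class.mult_sgn_abs sgn_if)
  finally have "u \<in> W'" using uW by (simp add: W'_def)
  then obtain \<delta> where \<delta>: "\<delta> > 0" "ball u \<delta> \<subseteq> W'" using opW' open_contains_ball by metis
  have sub: "ball u \<delta> \<subseteq> W" using \<delta> by (auto simp: W'_def)
  show thesis
  proof (rule that[of "ball u \<delta>" s s'])
    show "open (ball u \<delta>)" "is_interval (ball u \<delta>)" "u \<in> ball u \<delta>" "s u = 0"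
      using \<delta> by (auto simp: is_interval_ball_real s_def)
    show "continuous_on (ball u \<delta>) s'" using cont sub continuous_on_subset by blast
    fix \<phi> assume "\<phi> \<in> ball u \<delta>"
    then have \<phi>W: "\<phi> \<in> W" and "\<phi> \<in> W'" using sub \<delta> by auto
    then show "s' \<phi> * \<phi> ^ 3 > 0" by (simp add: W'_def)
    have \<phi>: "\<phi> \<noteq> 0" "R \<phi> > 0" using W[OF \<phi>W] by auto
    have dR: "(R has_real_derivative \<eta> * \<alpha>\<^sub>1 * \<phi>) (at \<phi>)"
      unfolding R_def by (auto intro!: derivative_eq_intros)
    have dq: "(q has_real_derivative \<eta> * \<alpha>\<^sub>1 * \<phi> / (2 * q \<phi>)) (at \<phi>)"
      unfolding q_def using DERIV_chain2[OF DERIV_real_sqrt[OF \<phi>(2)] dR] by (simp add: field_simps)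
    have "((\<lambda>\<phi>. (\<phi>\<^sup>2 - u\<^sup>2) * q \<phi>) has_real_derivative
        2 * \<phi> * q \<phi> + (\<phi>\<^sup>2 - u\<^sup>2) * (\<eta> * \<alpha>\<^sub>1 * \<phi> / (2 * q \<phi>))) (at \<phi>)"
      by (rule derivative_eq_intros dq refl | simp)+
    from DERIV_cmult[OF DERIV_quotient[OF this DERIV_ident \<phi>(1)], of "sgn u"]
    show "(s has_real_derivative s' \<phi>) (at \<phi>)"
      by (simp add: s_def[abs_def] s'_def numeral_2_eq_2)
    define r where "r = q \<phi>"
    have r: "r > 0" "r * r = R \<phi>" using \<phi> by (simp_all add: r_def q_def)
    have sg: "sgn u * sgn u = 1" using u by (simp add: sgn_if)
    have "s \<phi> * (s' \<phi> * \<phi> ^ 3) = (sgn u * sgn u) * ((\<phi>\<^sup>2 - u\<^sup>2) * (2 * \<phi>\<^sup>2 * (r * r)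
        + (\<phi>\<^sup>2 - u\<^sup>2) * \<eta> * \<alpha>\<^sub>1 * \<phi>\<^sup>2 / 2 - (\<phi>\<^sup>2 - u\<^sup>2) * (r * r)))"
      unfolding s_def s'_def r_def[symmetric] using r(1) \<phi>(1)
      by (simp add: field_simps power2_eq_square power3_eq_cube)
    also have "\<dots> = \<eta> * ((\<phi>\<^sup>2 - u\<^sup>2) * (\<alpha>\<^sub>1 * (\<phi> ^ 4 + \<phi>\<^sup>2 * u\<^sup>2 + u ^ 4) + \<alpha>\<^sub>2 * (\<phi>\<^sup>2 + u\<^sup>2)))"
      unfolding sg r(2) R_def by (simp add: field_simps power2_eq_square power4_eq_xxxx)
    also have "(\<phi>\<^sup>2 - u\<^sup>2) * (\<alpha>\<^sub>1 * (\<phi> ^ 4 + \<phi>\<^sup>2 * u\<^sup>2 + u ^ 4) + \<alpha>\<^sub>2 * (\<phi>\<^sup>2 + u\<^sup>2))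
        = \<alpha>\<^sub>1 * \<phi> ^ 6 + \<alpha>\<^sub>2 * \<phi> ^ 4 + \<alpha>\<^sub>3 - (\<alpha>\<^sub>1 * u ^ 6 + \<alpha>\<^sub>2 * u ^ 4 + \<alpha>\<^sub>3)"
      by (simp add: algebra_simps power2_eq_square eval_nat_numeral)
    finally have "s \<phi> * (s' \<phi> * \<phi> ^ 3) = \<eta> * (\<alpha>\<^sub>1 * \<phi> ^ 6 + \<alpha>\<^sub>2 * \<phi> ^ 4 + \<alpha>\<^sub>3)" using root by simp
    then have "\<eta> * (s \<phi> * (s' \<phi> * \<phi> ^ 3)) = \<eta>\<^sup>2 * (\<alpha>\<^sub>1 * \<phi> ^ 6 + \<alpha>\<^sub>2 * \<phi> ^ 4 + \<alpha>\<^sub>3)"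
      by (simp add: power2_eq_square)
    then show "\<alpha>\<^sub>1 * \<phi> ^ 6 + \<alpha>\<^sub>2 * \<phi> ^ 4 + \<alpha>\<^sub>3 = \<eta> * s \<phi> * (s' \<phi> * \<phi> ^ 3)"
      using \<eta>(1) by simp
  qed
qed

lemma inj_on_interval_of_deriv_nonzero:
  fixes s :: "real \<Rightarrow> real"
  assumes J: "is_interval J" and deriv: "\<And>t. t \<in> J \<Longrightarrow> (s has_real_derivative s' t) (at t)"
    and nz: "\<And>t. t \<in> J \<Longrightarrow> s' t \<noteq> 0"
  shows "inj_on s J"
proof (rule linorder_inj_onI')
  fix a b assume ab: "a \<in> J" "b \<in> J" "a < b"
  have sub: "{a..b} \<subseteq> J" using J ab by (meson atLeastAtMost_iff mem_is_interval_1_I subsetI)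
  then obtain z where z: "a < z" "z < b" "s b - s a = (b - a) * s' z"
    using MVT2[OF \<open>a < b\<close>, of s s'] deriv by (metis atLeastAtMost_iff subsetD)
  then have "z \<in> J" using sub by auto
  then show "s a \<noteq> s b" using z nz[of z] ab by auto
qed

text \<open>With \<eta> = -1 the first integral becomes y^2 + s^2, and in the chart (s, y) the field
  is s' \<phi>^3 times (y, -s), whose orbits are circles.\<close>

lemma planar_field_center:
  assumes u: "u \<noteq> 0" and root: "\<alpha>\<^sub>1 * u ^ 6 + \<alpha>\<^sub>2 * u ^ 4 + \<alpha>\<^sub>3 = 0"
    and neg: "3 * \<alpha>\<^sub>1 * u\<^sup>2 + 2 * \<alpha>\<^sub>2 < 0"
  shows "is_center (planar_field \<alpha>\<^sub>1 \<alpha>\<^sub>2 \<alpha>\<^sub>3) (u, 0)"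
proof -
  obtain J s s' where J: "open J" "is_interval J" "u \<in> J" and su: "s u = 0"
    and s: "\<And>\<phi>. \<phi> \<in> J \<Longrightarrow> (s has_real_derivative s' \<phi>) (at \<phi>)" and cont: "continuous_on J s'"
    and pos: "\<And>\<phi>. \<phi> \<in> J \<Longrightarrow> s' \<phi> * \<phi> ^ 3 > 0"
    and eq: "\<And>\<phi>. \<phi> \<in> J \<Longrightarrow> \<alpha>\<^sub>1 * \<phi> ^ 6 + \<alpha>\<^sub>2 * \<phi> ^ 4 + \<alpha>\<^sub>3 = - 1 * s \<phi> * (s' \<phi> * \<phi> ^ 3)"
    using energy_chart[OF u root, of "- 1"] neg by (auto simp: algebra_simps)
  have nz: "s' \<phi> \<noteq> 0" if "\<phi> \<in> J" for \<phi> using pos[OF that] by auto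
  have inj: "inj_on s J" by (rule inj_on_interval_of_deriv_nonzero[OF J(2) s nz])
  let ?O = "J \<times> (UNIV :: real set)"
  show ?thesis
  proof (rule is_center_rotation[of ?O "\<lambda>x. (s (fst x), snd x)" "(u, 0)"
        "\<lambda>x d. (s' (fst x) * fst d, snd d)" _ "\<lambda>x. s' (fst x) * fst x ^ 3"])
    show "open ?O" using J(1) by (simp add: open_Times)
    show "inj_on (\<lambda>x. (s (fst x), snd x)) ?O"
      using inj by (auto simp: inj_on_def)
    show "(u, 0) \<in> ?O" "(s (fst (u, 0)), snd (u, 0)) = 0" using J(3) su by (simp_all add: zero_prod_def)
    show "continuous_on ?O (\<lambda>x. s' (fst x) * fst x ^ 3)"
      by (intro continuous_intros continuous_on_compose2[OF cont]) auto
    fix x assume x: "x \<in> ?O"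
    show "((\<lambda>x. (s (fst x), snd x)) has_derivative (\<lambda>d. (s' (fst x) * fst d, snd d))) (at x)"
      using DERIV_compose_FDERIV[OF s[of "fst x"] has_derivative_fst[OF has_derivative_ident], of UNIV] x
      by (auto intro!: has_derivative_Pair derivative_intros simp: mult.commute)
    show "inj (\<lambda>d. (s' (fst x) * fst d, snd d))"
      using nz[of "fst x"] x by (auto simp: inj_on_def)
    show "s' (fst x) * fst x ^ 3 > 0" using pos x by auto
    show "(s' (fst x) * fst (planar_field \<alpha>\<^sub>1 \<alpha>\<^sub>2 \<alpha>\<^sub>3 x), snd (planar_field \<alpha>\<^sub>1 \<alpha>\<^sub>2 \<alpha>\<^sub>3 x)) =
        (s' (fst x) * fst x ^ 3) *\<^sub>R rotation_field (s (fst x), snd x)"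
      using eq[of "fst x"] x by (auto simp: planar_field_def rotation_field_def)
  qed
qed

lemma planar_field_has_derivative:
  "(planar_field \<alpha>\<^sub>1 \<alpha>\<^sub>2 \<alpha>\<^sub>3 has_derivative
    (\<lambda>d. (3 * \<phi>\<^sup>2 * y * fst d + \<phi> ^ 3 * snd d, (6 * \<alpha>\<^sub>1 * \<phi> ^ 5 + 4 * \<alpha>\<^sub>2 * \<phi> ^ 3) * fst d))) (at (\<phi>, y))"
proof -
  let ?x = "(\<phi>, y)"
  have fst': "(fst has_derivative fst) (at ?x)" and snd': "(snd has_derivative snd) (at ?x)"
    by (intro bounded_linear_imp_has_derivative bounded_linear_fst bounded_linear_snd)+
  have "((\<lambda>\<phi>. \<phi> ^ 3) has_real_derivative 3 * \<phi>\<^sup>2) (at (fst ?x))"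
    by (auto intro!: derivative_eq_intros)
  from has_derivative_mult[OF DERIV_compose_FDERIV[OF this fst'] snd']
  have 1: "((\<lambda>x. fst x ^ 3 * snd x) has_derivative (\<lambda>d. 3 * \<phi>\<^sup>2 * y * fst d + \<phi> ^ 3 * snd d)) (at ?x)"
    by (simp add: ac_simps)
  have "((\<lambda>\<phi>. \<alpha>\<^sub>1 * \<phi> ^ 6 + \<alpha>\<^sub>2 * \<phi> ^ 4 + \<alpha>\<^sub>3) has_real_derivative 6 * \<alpha>\<^sub>1 * \<phi> ^ 5 + 4 * \<alpha>\<^sub>2 * \<phi> ^ 3) (at (fst ?x))"
    by (auto intro!: derivative_eq_intros)
  from has_derivative_Pair[OF 1 DERIV_compose_FDERIV[OF this fst']]
  show ?thesis unfolding planar_field_def case_prod_beta by (simp add: mult.commute)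
qed

text \<open>With \<eta> = 1 the field is s' \<phi>^3 times (y, s) in the chart (s, y), and the
  combinations y + s and y - s diagonalise it to the linear saddle. The Jacobian at (u, 0) is
  antidiagonal with entries of the same sign, hence has two opposite real eigenvalues.\<close>

lemma planar_field_saddle:
  assumes u: "u \<noteq> 0" and root: "\<alpha>\<^sub>1 * u ^ 6 + \<alpha>\<^sub>2 * u ^ 4 + \<alpha>\<^sub>3 = 0"
    and pos': "3 * \<alpha>\<^sub>1 * u\<^sup>2 + 2 * \<alpha>\<^sub>2 > 0"
  shows "is_saddle (planar_field \<alpha>\<^sub>1 \<alpha>\<^sub>2 \<alpha>\<^sub>3) (u, 0)"
proof -
  let ?F = "planar_field \<alpha>\<^sub>1 \<alpha>\<^sub>2 \<alpha>\<^sub>3"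
  obtain J s s' where J: "open J" "is_interval J" "u \<in> J" and su: "s u = 0"
    and s: "\<And>\<phi>. \<phi> \<in> J \<Longrightarrow> (s has_real_derivative s' \<phi>) (at \<phi>)" and cont: "continuous_on J s'"
    and pos: "\<And>\<phi>. \<phi> \<in> J \<Longrightarrow> s' \<phi> * \<phi> ^ 3 > 0"
    and eq: "\<And>\<phi>. \<phi> \<in> J \<Longrightarrow> \<alpha>\<^sub>1 * \<phi> ^ 6 + \<alpha>\<^sub>2 * \<phi> ^ 4 + \<alpha>\<^sub>3 = 1 * s \<phi> * (s' \<phi> * \<phi> ^ 3)"
    using energy_chart[OF u root, of 1] pos' by auto
  have nz: "s' \<phi> \<noteq> 0" if "\<phi> \<in> J" for \<phi> using pos[OF that] by auto
  have inj: "inj_on s J" by (rule inj_on_interval_of_deriv_nonzero[OF J(2) s nz])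
  let ?O = "J \<times> (UNIV :: real set)"
  have "\<exists>U V h. open U \<and> (u, 0) \<in> U \<and> open V \<and> 0 \<in> V \<and> h (u, 0) = 0 \<and>
      orbit_equivalence ?F U linear_saddle V h"
  proof (rule orbit_equivalence_linear_saddle[of ?O "\<lambda>x. (snd x + s (fst x), snd x - s (fst x))" "(u, 0)"
        "\<lambda>x d. (snd d + s' (fst x) * fst d, snd d - s' (fst x) * fst d)" _ "\<lambda>x. s' (fst x) * fst x ^ 3"])
    show "open ?O" using J(1) by (simp add: open_Times)
    show "inj_on (\<lambda>x. (snd x + s (fst x), snd x - s (fst x))) ?O"
    proof (rule inj_onI)
      fix x y assume xy: "x \<in> ?O" "y \<in> ?O"
        "(snd x + s (fst x), snd x - s (fst x)) = (snd y + s (fst y), snd y - s (fst y))"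
      then have "snd x = snd y" "s (fst x) = s (fst y)" by auto
      moreover have "fst x \<in> J" "fst y \<in> J" using xy by auto
      ultimately show "x = y" using inj_onD[OF inj] prod_eqI by blast
    qed
    show "(u, 0) \<in> ?O" "(snd (u, 0) + s (fst (u, 0)), snd (u, 0) - s (fst (u, 0))) = 0"
      using J(3) su by (simp_all add: zero_prod_def)
    show "continuous_on ?O (\<lambda>x. s' (fst x) * fst x ^ 3)"
      by (intro continuous_intros continuous_on_compose2[OF cont]) auto
    fix x assume x: "x \<in> ?O"
    have ds: "((\<lambda>x. s (fst x)) has_derivative (\<lambda>d. s' (fst x) * fst d)) (at x)"
      using DERIV_compose_FDERIV[OF s[of "fst x"] has_derivative_fst[OF has_derivative_ident], of UNIV] x
      by (auto simp: mult.commute)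
    show "((\<lambda>x. (snd x + s (fst x), snd x - s (fst x))) has_derivative
        (\<lambda>d. (snd d + s' (fst x) * fst d, snd d - s' (fst x) * fst d))) (at x)"
      by (intro has_derivative_Pair has_derivative_add has_derivative_diff ds has_derivative_snd has_derivative_ident)
    show "inj (\<lambda>d. (snd d + s' (fst x) * fst d, snd d - s' (fst x) * fst d))"
    proof (rule injI)
      fix d e :: "real \<times> real"
      assume "(snd d + s' (fst x) * fst d, snd d - s' (fst x) * fst d) =
        (snd e + s' (fst x) * fst e, snd e - s' (fst x) * fst e)"
      then have "snd d = snd e" "s' (fst x) * fst d = s' (fst x) * fst e"
        unfolding prod.inject by linarith+
      then show "d = e" using nz[of "fst x"] x by (auto simp: prod_eq_iff)
    qed
    show "s' (fst x) * fst x ^ 3 > 0" using pos x by auto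
    show "(snd (?F x) + s' (fst x) * fst (?F x), snd (?F x) - s' (fst x) * fst (?F x)) =
        (s' (fst x) * fst x ^ 3) *\<^sub>R linear_saddle (snd x + s (fst x), snd x - s (fst x))"
      using eq[of "fst x"] x by (auto simp: planar_field_def linear_saddle_def algebra_simps)
  qed
  moreover have "\<exists>l m. l < 0 \<and> 0 < m \<and> (\<exists>v. v \<noteq> 0 \<and> D v = l *\<^sub>R v) \<and> (\<exists>w. w \<noteq> 0 \<and> D w = m *\<^sub>R w)"
    if D: "(?F has_derivative D) (at (u, 0))" for D
  proof -
    define c where "c = 6 * \<alpha>\<^sub>1 * u ^ 5 + 4 * \<alpha>\<^sub>2 * u ^ 3"
    have D_eq: "D = (\<lambda>d. (u ^ 3 * snd d, c * fst d))"
      using has_derivative_unique[OF D planar_field_has_derivative] by (simp add: c_def)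
    have "u ^ 3 * c = 2 * u ^ 6 * (3 * \<alpha>\<^sub>1 * u\<^sup>2 + 2 * \<alpha>\<^sub>2)"
      by (simp add: c_def algebra_simps power2_eq_square eval_nat_numeral)
    also have "\<dots> > 0" using u pos' by simp
    finally have uc: "u ^ 3 * c > 0" .
    \<comment> \<open>For any \<open>e\<close> with \<open>e * e = u ^ 3 * c\<close>, the vector
      \<open>(u ^ 3, e)\<close> is an eigenvector with eigenvalue \<open>e\<close>; both square
      roots are used.\<close>
    define l where "l = sqrt (u ^ 3 * c)"
    have l: "l > 0" "l * l = u ^ 3 * c" using uc by (simp_all add: l_def)
    have "D (u ^ 3, e) = e *\<^sub>R (u ^ 3, e)" if "e * e = u ^ 3 * c" for e
      using that by (simp add: D_eq mult.commute)
    then have "D (u ^ 3, - l) = (- l) *\<^sub>R (u ^ 3, - l)" "D (u ^ 3, l) = l *\<^sub>R (u ^ 3, l)"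
      using l(2) by (metis minus_mult_minus)+
    moreover have "(u ^ 3, e) \<noteq> 0" for e using u by (simp add: zero_prod_def)
    moreover have "- l < 0" using l(1) by simp
    ultimately show ?thesis using l(1) by blast
  qed
  moreover have "(u, 0) \<in> equilibria ?F" using root by (simp add: equilibria_def planar_field_def zero_prod_def)
  ultimately show ?thesis unfolding is_saddle_def by blast
qed

section \<open>Cusps\<close>

text \<open>The solution must exist for all times of its own clock \<tau>, so \<tau> has to be
  unbounded. If it were bounded by M, Gronwall would keep \<gamma> at distance at least exp(- K M)
  |\<gamma> 0 - p| from \<open>p\<close>, contradicting the limit.\<close>

lemma solution_to_equilibrium:
  fixes \<gamma> :: "real \<Rightarrow> real \<times> real"
  assumes \<gamma>: "\<And>t. t \<ge> 0 \<Longrightarrow> (\<gamma> has_vector_derivative \<kappa> t *\<^sub>R F (\<gamma> t)) (at t)"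
    and pos: "\<And>t. \<kappa> t > 0" and cont: "continuous_on UNIV \<kappa>"
    and bound: "\<And>t. t \<ge> 0 \<Longrightarrow> norm (F (\<gamma> t)) \<le> K * norm (\<gamma> t - p)"
    and lim: "(\<gamma> \<longlongrightarrow> p) at_top" and \<gamma>0: "\<gamma> 0 \<noteq> p"
  shows "\<exists>x. is_solution F {0..} x \<and> x ` {0..} = \<gamma> ` {0..} \<and> (x \<longlongrightarrow> p) at_top"
proof -
  obtain \<tau>' where \<tau>': "\<And>t. (\<tau>' has_real_derivative \<kappa> t) (at t)"
    using has_real_antiderivative_UNIV[OF cont] by blast
  define \<tau> where "\<tau> t = \<tau>' t - \<tau>' 0" for t
  have \<tau>: "(\<tau> has_real_derivative \<kappa> t) (at t)" for t
    unfolding \<tau>_def[abs_def] using DERIV_diff[OF \<tau>'[of t] DERIV_const[of "\<tau>' 0" "at t"]] by simp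
  have mono: "strict_mono_on UNIV \<tau>"
    by (rule has_real_derivative_pos_imp_strict_mono_on[of _ _ \<kappa>]) (use \<tau> pos in auto)
  have \<tau>_le: "\<tau> a \<le> \<tau> b \<longleftrightarrow> a \<le> b" for a b
    using strict_mono_less_eq[OF mono] .
  have \<tau>0: "\<tau> 0 = 0" by (simp add: \<tau>_def)
  have \<tau>_nonneg: "\<tau> t \<ge> 0" if "t \<ge> 0" for t using \<tau>_le[of 0 t] that \<tau>0 by simp
  \<comment> \<open>Otherwise the field would vanish along \<gamma>, which would be constant and
    different from its limit \<open>p\<close>.\<close>
  have K: "K > 0"
  proof (rule ccontr)
    assume "\<not> K > 0"
    then have "K * norm (\<gamma> t - p) \<le> 0" for t by (simp add: mult_le_0_iff)
    then have F0: "F (\<gamma> t) = 0" if "t \<ge> 0" for t using bound[OF that] by (meson norm_le_zero_iff order_trans)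
    have const: "\<gamma> t = \<gamma> 0" if "t \<ge> 0" for t
    proof (rule has_derivative_zero_unique[of "{0..}" _ _ 0])
      show "(\<gamma> has_derivative (\<lambda>h. 0)) (at s within {0..})" if "s \<in> {0..}" for s
        using \<gamma>[of s] F0[of s] that by (auto simp: has_vector_derivative_def intro: has_derivative_at_withinI)
    qed (use that in auto)
    have "\<forall>\<^sub>F t in at_top. \<gamma> t = \<gamma> 0"
      by (rule eventually_mono[OF eventually_ge_at_top[of 0]]) (rule const)
    then have "(\<gamma> \<longlongrightarrow> \<gamma> 0) at_top" by (rule tendsto_eventually)
    then show False using tendsto_unique[OF trivial_limit_at_top_linorder lim] \<gamma>0 by metis
  qed
  have unbounded: "\<exists>t\<ge>0. \<tau> t \<ge> M" for M
  proof (rule ccontr)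
    assume "\<not> ?thesis"
    then have M: "\<tau> t \<le> M" if "t \<ge> 0" for t using that by force
    have below: "exp (- (K * M)) * norm (\<gamma> 0 - p) \<le> norm (\<gamma> t - p)" if t: "t \<ge> 0" for t
    proof -
      have "norm (\<gamma> 0 - p) \<le> exp \<bar>K * \<tau> t - K * \<tau> 0\<bar> * norm (\<gamma> t - p)"
      proof (rule gronwall_near_point[of "{0..}"])
        fix s :: real assume s: "s \<in> {0..}"
        then show "(\<gamma> has_vector_derivative \<kappa> s *\<^sub>R F (\<gamma> s)) (at s within {0..})"
          using \<gamma> by (auto intro: has_vector_derivative_at_within)
        show "((\<lambda>t. K * \<tau> t) has_real_derivative K * \<kappa> s) (at s within {0..})"
          using DERIV_cmult[OF \<tau>] has_field_derivative_at_within by blast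
        show "0 \<le> K * \<kappa> s" using K pos[of s] by simp
        have "\<kappa> s * norm (F (\<gamma> s)) \<le> \<kappa> s * (K * norm (\<gamma> s - p))"
          using bound[of s] s pos[of s] by (intro mult_left_mono) auto
        then show "norm (\<kappa> s *\<^sub>R F (\<gamma> s)) \<le> K * \<kappa> s * norm (\<gamma> s - p)"
          using pos[of s] by (simp add: ac_simps)
      qed (use t in \<open>auto simp: is_interval_ci\<close>)
      also have "\<dots> \<le> exp (K * M) * norm (\<gamma> t - p)"
        using K M[OF t] \<tau>_nonneg[OF t] \<tau>0 by (intro mult_right_mono) auto
      finally show ?thesis by (simp add: exp_minus field_simps)
    qed
    have "((\<lambda>t. norm (\<gamma> t - p)) \<longlongrightarrow> norm (p - p)) at_top"
      by (intro tendsto_intros lim)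
    moreover have "\<forall>\<^sub>F t in at_top. exp (- (K * M)) * norm (\<gamma> 0 - p) \<le> norm (\<gamma> t - p)"
      by (rule eventually_mono[OF eventually_ge_at_top[of 0]]) (rule below)
    ultimately have "exp (- (K * M)) * norm (\<gamma> 0 - p) \<le> norm (p - p)"
      using tendsto_lowerbound trivial_limit_at_top_linorder by blast
    then show False using \<gamma>0 by (simp add: mult_le_0_iff)
  qed
  have image: "\<tau> ` {0..} = {0..}"
  proof (intro equalityI subsetI)
    fix s :: real assume s: "s \<in> {0..}"
    obtain b where b: "b \<ge> 0" "\<tau> b \<ge> s" using unbounded by blast
    have "continuous_on {0..b} \<tau>" using \<tau> by (meson DERIV_continuous_on has_field_derivative_at_within)
    then obtain t where "0 \<le> t" "t \<le> b" "\<tau> t = s" using IVT'[of \<tau> 0 s b] s b \<tau>0 by auto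
    then show "s \<in> \<tau> ` {0..}" by auto
  qed (use \<tau>_nonneg in auto)
  obtain \<sigma> where hom: "homeomorphism {0..} (\<tau> ` {0..}) \<tau> \<sigma>" and sol: "is_solution F (\<tau> ` {0..}) (\<gamma> \<circ> \<sigma>)"
    by (rule is_solution_time_change[of "{0..}" \<gamma> \<kappa> F \<tau>])
      (use \<gamma> \<tau> pos in \<open>auto simp: is_interval_ci intro: has_vector_derivative_at_within has_field_derivative_at_within\<close>)
  have im\<sigma>: "\<sigma> ` {0..} = {0..}" and \<tau>\<sigma>: "\<And>s. s \<ge> 0 \<Longrightarrow> \<tau> (\<sigma> s) = s"
    using hom image by (simp_all add: homeomorphism_def)
  have "filterlim \<sigma> at_top at_top"
    unfolding filterlim_at_top
  proof
    fix Z :: real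
    have "\<forall>\<^sub>F s in at_top. s \<ge> max 0 (\<tau> Z)" by (rule eventually_ge_at_top)
    then show "\<forall>\<^sub>F s in at_top. Z \<le> \<sigma> s"
    proof (rule eventually_mono)
      fix s assume "max 0 (\<tau> Z) \<le> s"
      then have "\<tau> Z \<le> \<tau> (\<sigma> s)" using \<tau>\<sigma>[of s] by simp
      then show "Z \<le> \<sigma> s" using \<tau>_le by blast
    qed
  qed
  then have "((\<gamma> \<circ> \<sigma>) \<longlongrightarrow> p) at_top" unfolding comp_def using filterlim_compose[OF lim] by blast
  moreover have "(\<gamma> \<circ> \<sigma>) ` {0..} = \<gamma> ` {0..}" using im\<sigma> by (metis image_comp)
  ultimately show ?thesis using sol image by metis
qed

text \<open>For the linear saddle a b is a first integral and a - b has velocity a + b, so these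
  coordinates make its orbits horizontal and run to the right. The values \<eta> = 1 and \<eta> = -1
  open the quadrant above and below the axis; its sides a = 0 and b = 0 become the negative and the
  positive half axis.\<close>

definition quadrant_coords :: "real \<Rightarrow> real \<times> real \<Rightarrow> real \<times> real"
  where "quadrant_coords \<eta> x = (fst x - snd x, \<eta> * (fst x * snd x))"

lemma continuous_on_quadrant_coords: "continuous_on S (quadrant_coords \<eta>)"
  unfolding quadrant_coords_def[abs_def] by (intro continuous_intros)

text \<open>The identity (a + b)^2 = (a - b)^2 + 4 a b recovers a + b up to a sign, which the
  assumption fixes.\<close>

lemma quadrant_coords_inj:
  assumes "\<eta> \<noteq> 0" "fst x + snd x \<ge> 0" "fst y + snd y \<ge> 0" "quadrant_coords \<eta> x = quadrant_coords \<eta> y"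
  shows "x = y"
proof -
  have d: "fst x - snd x = fst y - snd y" and m: "fst x * snd x = fst y * snd y"
    using assms by (auto simp: quadrant_coords_def)
  have "(fst x + snd x)\<^sup>2 = (fst x - snd x)\<^sup>2 + 4 * (fst x * snd x)"
    by (simp add: power2_eq_square algebra_simps)
  also have "\<dots> = (fst y + snd y)\<^sup>2"
    unfolding d m by (simp add: power2_eq_square algebra_simps)
  finally have "fst x + snd x = fst y + snd y" using assms by (simp add: power2_eq_iff_nonneg)
  then show ?thesis using d by (auto simp: prod_eq_iff)
qed

text \<open>The derivative of the coordinates has determinant \<eta> (a + b), and the saddle field
  is sent to (a + b) times (1, 0). Both the diffeomorphism and the positive time factor thus come
  from a + b > 0, which on the closed quadrant fails only at the vertex.\<close>

lemma linear_saddle_flows_to_horizontal: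
  assumes \<eta>: "\<eta> \<noteq> 0" and Q: "Q \<subseteq> {x. fst x + snd x > 0}" and q: "q \<in> Q" "r \<in> Q"
  shows "flows_to linear_saddle Q q r \<longleftrightarrow>
    flows_to (\<lambda>_. (1, 0)) (quadrant_coords \<eta> ` Q) (quadrant_coords \<eta> q) (quadrant_coords \<eta> r)"
proof (rule flows_to_diffeo[OF _ Q _ _ _ _ _ _ q,
      of _ "\<lambda>x d. (fst d - snd d, \<eta> * (fst x * snd d + fst d * snd x))" _ "\<lambda>x. fst x + snd x"])
  show "open {x::real\<times>real. fst x + snd x > 0}"
    by (intro open_Collect_less continuous_intros)
  show "inj_on (quadrant_coords \<eta>) {x. fst x + snd x > 0}"
  proof (rule inj_onI)
    fix x y :: "real \<times> real"
    assume "x \<in> {x. fst x + snd x > 0}" "y \<in> {x. fst x + snd x > 0}" and eq: "quadrant_coords \<eta> x = quadrant_coords \<eta> y"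
    then have "fst x + snd x \<ge> 0" "fst y + snd y \<ge> 0" by simp_all
    then show "x = y" by (rule quadrant_coords_inj[OF \<eta> _ _ eq])
  qed
  show "continuous_on {x::real\<times>real. fst x + snd x > 0} (\<lambda>x. fst x + snd x)"
    by (intro continuous_intros)
  fix x :: "real \<times> real" assume "x \<in> {x. fst x + snd x > 0}"
  then have x: "fst x + snd x > 0" by simp
  then show "0 < fst x + snd x" .
  show "(quadrant_coords \<eta> has_derivative (\<lambda>d. (fst d - snd d, \<eta> * (fst x * snd d + fst d * snd x)))) (at x)"
    unfolding quadrant_coords_def[abs_def]
    by (intro has_derivative_Pair has_derivative_diff has_derivative_mult_right has_derivative_mult
        has_derivative_fst has_derivative_snd has_derivative_ident)
  show "inj (\<lambda>d. (fst d - snd d, \<eta> * (fst x * snd d + fst d * snd x)))"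
  proof (rule injI)
    fix d e :: "real \<times> real"
    assume "(fst d - snd d, \<eta> * (fst x * snd d + fst d * snd x)) = (fst e - snd e, \<eta> * (fst x * snd e + fst e * snd x))"
    then have 1: "fst d - fst e = snd d - snd e" and
      "fst x * snd d + fst d * snd x = fst x * snd e + fst e * snd x" using \<eta> by auto
    then have "fst x * (snd d - snd e) + (fst d - fst e) * snd x = 0" by (simp add: algebra_simps)
    then have "(fst x + snd x) * (snd d - snd e) = 0" unfolding 1 by (simp add: algebra_simps)
    then show "d = e" using x 1 by (auto simp: prod_eq_iff)
  qed
  show "(fst (linear_saddle x) - snd (linear_saddle x),
      \<eta> * (fst x * snd (linear_saddle x) + fst (linear_saddle x) * snd x)) = (fst x + snd x) *\<^sub>R (1, 0)"
    by (simp add: linear_saddle_def case_prod_beta)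
qed

text \<open>Here \<open>w\<close> is a + b, so a and b are (w + z)/2 and (w - z)/2. That both are at
  most 1 means w \<le> 2 - |z|, and squaring turns this into |z| + c \<le> 1: this is why the region
  is a diamond.\<close>

lemma quadrant_coords_surj:
  fixes z c :: real
  assumes "\<bar>z\<bar> + c \<le> 1" "c \<ge> 0"
  obtains a b where "a \<in> {0..1}" "b \<in> {0..1}" "z = a - b" "c = a * b"
proof -
  define w where "w = sqrt (z\<^sup>2 + 4 * c)"
  have w2: "w\<^sup>2 = z\<^sup>2 + 4 * c" and w0: "w \<ge> 0" using assms by (simp_all add: w_def)
  have "\<bar>z\<bar>\<^sup>2 \<le> w\<^sup>2" using w2 assms by simp
  then have wz: "\<bar>z\<bar> \<le> w" using w0 by (rule power2_le_imp_le)
  have "(2 - \<bar>z\<bar>)\<^sup>2 = 4 - 4 * \<bar>z\<bar> + z\<^sup>2" by (simp add: power2_diff)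
  then have "w\<^sup>2 \<le> (2 - \<bar>z\<bar>)\<^sup>2" using assms w2 by linarith
  then have w1: "w \<le> 2 - \<bar>z\<bar>" by (rule power2_le_imp_le) (use assms in auto)
  have "c = (w + z) / 2 * ((w - z) / 2)" using w2 by (simp add: power2_eq_square field_simps)
  moreover have "(w + z) / 2 \<in> {0..1}" "(w - z) / 2 \<in> {0..1}" using wz w1 by auto
  moreover have "z = (w + z) / 2 - (w - z) / 2" by (simp add: field_simps)
  ultimately show thesis using that by blast
qed

text \<open>The diamond \<open>\<bar>z\<bar> + \<bar>c\<bar> \<le> 1\<close> is cut by the axis \<open>c = 0\<close> into two triangles, and each of them
  is the image of the unit square under \<open>(a, b) \<mapsto> (a - b, \<plusminus>a b)\<close>, which makes the hyperbolas horizontal.\<close>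

lemma is_cusp_horizontal:
  fixes F \<Phi> :: "real \<times> real \<Rightarrow> real \<times> real"
  assumes op: "open O1" and inj\<Phi>: "inj_on \<Phi> O1" and surj: "\<Phi> ` O1 = UNIV" and p: "p \<in> O1" "\<Phi> p = 0"
    and cont\<Phi>: "continuous_on O1 \<Phi>"
    and deriv: "\<And>x. x \<in> O1 - {p} \<Longrightarrow> (\<Phi> has_derivative D x) (at x)"
    and inj: "\<And>x. x \<in> O1 - {p} \<Longrightarrow> inj (D x)"
    and push: "\<And>x. x \<in> O1 - {p} \<Longrightarrow> D x (F x) = \<kappa> x *\<^sub>R (1, 0)"
    and pos: "\<And>x. x \<in> O1 - {p} \<Longrightarrow> \<kappa> x > (0::real)"
    and cont: "continuous_on (O1 - {p}) \<kappa>"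
    and Fp: "F p = 0"
    and lip: "\<And>S. compact S \<Longrightarrow> \<exists>K. \<forall>x\<in>S. norm (F x) \<le> K * norm (x - p)"
    and rev: "\<And>x. x \<in> O1 \<Longrightarrow> (fst x, - snd x) \<in> O1 \<and> \<Phi> (fst x, - snd x) = (- fst (\<Phi> x), snd (\<Phi> x))"
    and revF: "\<And>x. F (fst x, - snd x) = (- fst (F x), snd (F x))"
  shows "is_cusp F p"
proof -
  obtain \<Psi> where hom: "homeomorphism O1 UNIV \<Phi> \<Psi>"
    using invariance_of_domain_homeomorphism[OF op cont\<Phi> order_refl inj\<Phi>] surj by metis
  have \<Psi>\<Phi>: "\<Psi> (\<Phi> x) = x" if "x \<in> O1" for x using homeomorphism_apply1[OF hom that] .
  have \<Phi>\<Psi>: "\<Phi> (\<Psi> z) = z" for z using homeomorphism_apply2[OF hom] by simp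
  have \<Psi>O: "\<Psi> z \<in> O1" for z using hom by (auto simp: homeomorphism_def)
  have cont\<Psi>: "continuous_on S \<Psi>" for S
    using hom continuous_on_subset unfolding homeomorphism_def by blast
  have inj\<Psi>: "\<Psi> z = \<Psi> w \<longleftrightarrow> z = w" for z w using \<Phi>\<Psi> by metis
  have \<Psi>0: "\<Psi> 0 = p" using \<Psi>\<Phi> p by metis
  have opp: "open (O1 - {p})" using op by (simp add: open_delete)
  have inj\<Phi>': "inj_on \<Phi> (O1 - {p})" using inj\<Phi> by (rule inj_on_subset) auto
  define Q :: "(real \<times> real) set" where "Q = {0..1} \<times> {0..1}"
  define h where "h \<eta> = \<Psi> \<circ> quadrant_coords \<eta>" for \<eta>
  \<comment> \<open>The flow runs to the right, so the negative half axis is the separatrix into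
    \<open>p\<close> and the positive one leaves \<open>p\<close>.\<close>
  define A where "A = \<Psi> ` ({- 1..<0} \<times> {0})"
  define B where "B = \<Psi> ` ({0<..1} \<times> {0})"
  have Q0: "Q - {0} \<subseteq> {x. fst x + snd x > 0}"
    by (auto simp: Q_def zero_prod_def)
  have h0: "h \<eta> 0 = p" for \<eta> using \<Psi>0 by (simp add: h_def quadrant_coords_def zero_prod_def)
  have \<Phi>h: "\<Phi> (h \<eta> x) = quadrant_coords \<eta> x" for \<eta> x using \<Phi>\<Psi> by (simp add: h_def)
  have inj_h: "inj_on (h \<eta>) Q" if "\<eta> \<noteq> 0" for \<eta>
  proof (rule inj_onI)
    fix x y assume "x \<in> Q" "y \<in> Q" "h \<eta> x = h \<eta> y"
    then show "x = y" using quadrant_coords_inj[OF that, of x y] \<Phi>h[of \<eta>] by (metis (no_types) Q_def add_nonneg_nonneg atLeastAtMost_iff mem_Times_iff)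
  qed
  have cpt_Q: "compact Q" unfolding Q_def by (intro compact_Times compact_Icc)
  have cont_h: "continuous_on Q (h \<eta>)" for \<eta>
    unfolding h_def by (intro continuous_on_compose continuous_on_quadrant_coords cont\<Psi>)
  have cpt_h: "compact (h \<eta> ` Q)" for \<eta> using compact_continuous_image[OF cont_h cpt_Q] .
  have sector: "hyperbolic_sector F p (h \<eta> ` Q) A B" if \<eta>: "\<eta> \<noteq> 0" for \<eta>
  proof -
    obtain k where k: "homeomorphism Q (h \<eta> ` Q) (h \<eta>) k"
      using homeomorphism_compact[OF cpt_Q cont_h refl inj_h[OF \<eta>]] by blast
    obtain K where K: "\<And>x. x \<in> h \<eta> ` Q \<Longrightarrow> norm (F x) \<le> K * norm (x - p)"
      using lip[OF cpt_h] by blast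
    have "orbit_equivalence linear_saddle Q F (h \<eta> ` Q) (h \<eta>)"
    proof (rule orbit_equivalence_puncture[OF k, of 0 _ 1 _ K])
      show "0 \<in> Q" by (simp add: Q_def zero_prod_def)
      show "norm (linear_saddle x) \<le> 1 * norm (x - 0)" for x
        by (simp add: linear_saddle_def case_prod_beta norm_prod_def)
      show "norm (F x) \<le> K * norm (x - h \<eta> 0)" if "x \<in> h \<eta> ` Q" for x using K[OF that] h0 by simp
      fix q r assume qr: "q \<in> Q - {0}" "r \<in> Q - {0}"
      have img: "h \<eta> ` Q - {h \<eta> 0} = h \<eta> ` (Q - {0})"
        using inj_on_image_set_diff[OF inj_h[OF \<eta>], of Q "{0}"] by (simp add: Q_def zero_prod_def)
      have sub: "h \<eta> ` (Q - {0}) \<subseteq> O1 - {p}"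
      proof
        fix x assume x: "x \<in> h \<eta> ` (Q - {0})"
        then have "x \<noteq> p" unfolding img[symmetric] h0 by blast
        moreover have "x \<in> O1" using x \<Psi>O unfolding h_def comp_def by blast
        ultimately show "x \<in> O1 - {p}" by blast
      qed
      \<comment> \<open>Both \<open>F\<close> and the linear saddle are compared with the constant
        field (1, 0) on the same set, the punctured triangle.\<close>
      have "flows_to F (h \<eta> ` (Q - {0})) (h \<eta> q) (h \<eta> r) \<longleftrightarrow>
          flows_to (\<lambda>_. (1, 0)) (\<Phi> ` (h \<eta> ` (Q - {0}))) (\<Phi> (h \<eta> q)) (\<Phi> (h \<eta> r))"
        by (rule flows_to_diffeo[OF opp sub inj\<Phi>' deriv inj push pos cont]) (use qr in auto)
      moreover have "\<Phi> ` (h \<eta> ` (Q - {0})) = quadrant_coords \<eta> ` (Q - {0})"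
        using \<Phi>h by (simp add: image_image)
      ultimately show "flows_to linear_saddle (Q - {0}) q r \<longleftrightarrow> flows_to F (h \<eta> ` Q - {h \<eta> 0}) (h \<eta> q) (h \<eta> r)"
        using linear_saddle_flows_to_horizontal[OF \<eta> Q0 qr] \<Phi>h img by simp
    qed
    moreover have "A = h \<eta> ` ({0} \<times> {0<..1})"
    proof -
      have "quadrant_coords \<eta> ` ({0} \<times> {0<..1}) = (\<lambda>b. (- b, 0)) ` {0<..1}"
        by (auto simp: quadrant_coords_def image_iff)
      also have "\<dots> = {- 1..<0} \<times> {0}"
      proof (intro equalityI subsetI)
        fix z :: "real \<times> real" assume "z \<in> {- 1..<0} \<times> {0}"
        then have "z = (- (- fst z), 0)" "- fst z \<in> {0<..1}" by auto
        then show "z \<in> (\<lambda>b. (- b, 0)) ` {0<..1}" by blast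
      qed auto
      finally show ?thesis by (metis A_def h_def image_comp)
    qed
    moreover have "B = h \<eta> ` ({0<..1} \<times> {0})"
    proof -
      have "quadrant_coords \<eta> ` ({0<..1} \<times> {0}) = {0<..1} \<times> {0}"
        by (force simp: quadrant_coords_def image_iff)
      then show ?thesis by (metis B_def h_def image_comp)
    qed
    ultimately show ?thesis unfolding hyperbolic_sector_def Q_def using h0 by blast
  qed
  \<comment> \<open>One sector has c \<ge> 0 and the other c \<le> 0, so they share only the segment
    of the axis c = 0, that is, the vertex and the two sides.\<close>
  have inter: "h 1 ` Q \<inter> h (- 1) ` Q = {p} \<union> A \<union> B"
  proof (intro equalityI subsetI)
    fix x assume "x \<in> h 1 ` Q \<inter> h (- 1) ` Q"
    then obtain q r where q: "q \<in> Q" "x = h 1 q" and r: "r \<in> Q" "x = h (- 1) r" by auto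
    then have "quadrant_coords 1 q = quadrant_coords (- 1) r" using \<Phi>h by metis
    then have "fst q * snd q = - (fst r * snd r)" by (simp add: quadrant_coords_def)
    moreover have "fst q * snd q \<ge> 0" "fst r * snd r \<ge> 0" using q r by (auto simp: Q_def)
    ultimately have z: "fst q * snd q = 0" by linarith
    have c: "quadrant_coords 1 q = (fst q - snd q, 0)" using z by (simp add: quadrant_coords_def)
    have rng: "fst q - snd q \<in> {- 1..1}" using q(1) by (auto simp: Q_def)
    consider "fst q - snd q < 0" | "fst q - snd q = 0" | "fst q - snd q > 0" by linarith
    then show "x \<in> {p} \<union> A \<union> B"
    proof cases
      case 1 then show ?thesis using c rng q(2) by (auto simp: A_def h_def)
    next
      case 2 then show ?thesis using c q(2) \<Psi>0 by (simp add: h_def zero_prod_def)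
    next
      case 3 then show ?thesis using c rng q(2) by (auto simp: B_def h_def)
    qed
  next
    fix x assume "x \<in> {p} \<union> A \<union> B"
    then obtain t where t: "x = \<Psi> (t, 0)" "t \<in> {- 1..1}"
      using \<Psi>0 by (auto simp: A_def B_def zero_prod_def intro: that[of 0])
    \<comment> \<open>The positive and negative parts of \<open>t\<close> have difference
      \<open>t\<close> and product 0, so this point serves both signs of \<eta>.\<close>
    define q where "q = (max t 0, max (- t) 0)"
    have "q \<in> Q" using t by (auto simp: q_def Q_def)
    moreover have "quadrant_coords \<eta> q = (t, 0)" for \<eta> by (auto simp: q_def quadrant_coords_def max_def)
    then have "x = h 1 q" "x = h (- 1) q" using t by (simp_all add: h_def)
    ultimately show "x \<in> h 1 ` Q \<inter> h (- 1) ` Q" by blast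
  qed
  have int: "p \<in> interior (h 1 ` Q \<union> h (- 1) ` Q)"
  proof (rule interiorI)
    let ?T = "{x::real\<times>real. \<bar>fst x\<bar> + \<bar>snd x\<bar> < 1}"
    have "open ?T" by (intro open_Collect_less continuous_intros)
    then show "open (O1 \<inter> \<Phi> -` ?T)" by (rule continuous_open_preimage[OF cont\<Phi> op])
    show "p \<in> O1 \<inter> \<Phi> -` ?T" using p by simp
    show "O1 \<inter> \<Phi> -` ?T \<subseteq> h 1 ` Q \<union> h (- 1) ` Q"
    proof
      fix x assume x: "x \<in> O1 \<inter> \<Phi> -` ?T"
      obtain z c where "\<Phi> x = (z, c)" by (cases "\<Phi> x")
      then have T: "\<bar>z\<bar> + \<bar>c\<bar> \<le> 1" and x_eq: "x = \<Psi> (z, c)" using x \<Psi>\<Phi>[of x] by auto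
      obtain a b where ab: "a \<in> {0..1}" "b \<in> {0..1}" "z = a - b" "\<bar>c\<bar> = a * b"
        using quadrant_coords_surj[OF T] by auto
      then have "(a, b) \<in> Q" by (simp add: Q_def)
      moreover have "x = h 1 (a, b) \<or> x = h (- 1) (a, b)"
      proof -
        have "c = a * b \<or> c = - (a * b)" using ab(4) by linarith
        then show ?thesis using ab(3) x_eq by (auto simp: h_def quadrant_coords_def)
      qed
      ultimately show "x \<in> h 1 ` Q \<union> h (- 1) ` Q" by blast
    qed
  qed
  have exA: "\<exists>x. is_solution F {0..} x \<and> A = x ` {0..} \<and> (x \<longlongrightarrow> p) at_top"
  proof -
    obtain \<Psi>' E where "open (\<Phi> ` (O1 - {p}))" and hom': "homeomorphism (O1 - {p}) (\<Phi> ` (O1 - {p})) \<Phi> \<Psi>'"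
      and deriv\<Psi>': "\<And>x. x \<in> O1 - {p} \<Longrightarrow> (\<Psi>' has_derivative E x) (at (\<Phi> x))"
      and E: "\<And>x. x \<in> O1 - {p} \<Longrightarrow> linear (E x)" "\<And>x. x \<in> O1 - {p} \<Longrightarrow> E x \<circ> D x = id"
      by (rule diffeo_inverse[OF opp inj\<Phi>' deriv inj]) (assumption | rule that)+
    \<comment> \<open>A parametrisation of the negative half axis from its endpoint (-1, 0) towards
      the vertex, reached only in the limit.\<close>
    define c :: "real \<Rightarrow> real \<times> real" where "c t = (- exp (- t), 0)" for t
    define \<gamma> where "\<gamma> = \<Psi> \<circ> c"
    have c0: "c t \<noteq> 0" for t by (simp add: c_def zero_prod_def)
    have \<gamma>O: "\<gamma> t \<in> O1 - {p}" for t using \<Psi>O c0 inj\<Psi> \<Psi>0 by (metis Diff_iff \<gamma>_def comp_apply singletonD)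
    have \<Phi>\<gamma>: "\<Phi> (\<gamma> t) = c t" for t by (simp add: \<gamma>_def \<Phi>\<Psi>)
    \<comment> \<open>The global inverse \<Psi> gives the limit at \<open>p\<close>, the inverse on
      the punctured set gives derivatives; along \<gamma> they agree.\<close>
    have \<gamma>': "\<gamma> = \<Psi>' \<circ> c"
    proof
      fix t
      have "\<Psi>' (\<Phi> (\<gamma> t)) = \<gamma> t" using homeomorphism_apply1[OF hom' \<gamma>O] .
      then show "\<gamma> t = (\<Psi>' \<circ> c) t" by (simp add: \<Phi>\<gamma>)
    qed
    have E_push: "E x (1, 0) = inverse (\<kappa> x) *\<^sub>R F x" if "x \<in> O1 - {p}" for x
    proof -
      have "(1, 0) = inverse (\<kappa> x) *\<^sub>R D x (F x)" using push[OF that] pos[OF that] by simp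
      then have "E x (1, 0) = inverse (\<kappa> x) *\<^sub>R (E x \<circ> D x) (F x)"
        using E(1)[OF that] by (metis comp_apply linear_cmul)
      then show ?thesis using E(2)[OF that] by simp
    qed
    \<comment> \<open>The first factor is the speed of \<open>c\<close>, and the second comes from
      pulling (1, 0) back to \<open>F\<close>.\<close>
    define w where "w t = exp (- t) * inverse (\<kappa> (\<gamma> t))" for t
    have cont\<gamma>: "continuous_on UNIV \<gamma>" unfolding \<gamma>_def c_def[abs_def]
      by (intro continuous_on_compose continuous_intros cont\<Psi>)
    have A_eq: "A = \<gamma> ` {0..}"
    proof -
      have "c ` {0..} = {- 1..<0} \<times> {0}"
      proof (intro equalityI subsetI)
        fix z :: "real \<times> real" assume z: "z \<in> {- 1..<0} \<times> {0}"
        then have "c (- ln (- fst z)) = z" "- ln (- fst z) \<ge> 0" by (auto simp: c_def)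
        then show "z \<in> c ` {0..}" by (metis atLeast_iff image_eqI)
      qed (auto simp: c_def)
      then show ?thesis by (metis A_def \<gamma>_def image_comp)
    qed
    have "\<Psi> ` ({- 1..0} \<times> {0}) = insert p A"
    proof -
      have "{- 1..0} \<times> {0} = insert 0 ({- 1..<0::real} \<times> {0::real})" by (auto simp: zero_prod_def)
      then show ?thesis using \<Psi>0 by (simp add: A_def)
    qed
    \<comment> \<open>Adjoining \<open>p\<close> closes the separatrix, so that \<open>lip\<close>
      yields one constant along all of it.\<close>
    then have "compact (insert p A)"
      using compact_continuous_image[OF cont\<Psi>, of "{- 1..0} \<times> {0}"] by (metis compact_Icc compact_Times compact_sing)
    then obtain K where K: "\<And>x. x \<in> insert p A \<Longrightarrow> norm (F x) \<le> K * norm (x - p)" using lip by blast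
    have "\<exists>x. is_solution F {0..} x \<and> x ` {0..} = \<gamma> ` {0..} \<and> (x \<longlongrightarrow> p) at_top"
    proof (rule solution_to_equilibrium[of _ w _ K])
      fix t :: real
      have "(c has_vector_derivative (exp (- t), 0)) (at t)"
        unfolding c_def[abs_def]
        by (auto intro!: has_vector_derivative_Pair derivative_eq_intros
            simp: has_real_derivative_iff_has_vector_derivative[symmetric])
      moreover have "(\<Psi>' has_derivative E (\<gamma> t)) (at (c t))" using deriv\<Psi>'[OF \<gamma>O[of t]] \<Phi>\<gamma> by simp
      ultimately have "(\<gamma> has_vector_derivative E (\<gamma> t) (exp (- t), 0)) (at t)"
        unfolding \<gamma>' using vector_derivative_diff_chain_within has_derivative_at_withinI by blast
      moreover have "E (\<gamma> t) (exp (- t), 0) = w t *\<^sub>R F (\<gamma> t)"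
        using linear_cmul[OF E(1)[OF \<gamma>O[of t]], of "exp (- t)" "(1, 0)"] E_push[OF \<gamma>O[of t]] by (simp add: w_def)
      ultimately show "(\<gamma> has_vector_derivative w t *\<^sub>R F (\<gamma> t)) (at t)" by simp
      show "w t > 0" using pos[OF \<gamma>O[of t]] by (simp add: w_def)
    next
      have "continuous_on UNIV (\<lambda>t. \<kappa> (\<gamma> t))" using continuous_on_compose2[OF cont cont\<gamma>] \<gamma>O by blast
      moreover have "\<kappa> (\<gamma> t) \<noteq> 0" for t using pos[OF \<gamma>O[of t]] by simp
      ultimately show "continuous_on UNIV w" unfolding w_def[abs_def] by (intro continuous_intros) auto
      show "norm (F (\<gamma> t)) \<le> K * norm (\<gamma> t - p)" if "t \<ge> 0" for t using K A_eq that by auto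
      have "((\<lambda>t. exp (- t)) \<longlongrightarrow> (0::real)) at_top"
        using exp_at_bot filterlim_compose filterlim_uminus_at_bot_at_top by blast
      from tendsto_Pair[OF tendsto_minus[OF this] tendsto_const, of 0]
      have "(c \<longlongrightarrow> 0) at_top" by (simp add: c_def[abs_def] zero_prod_def)
      moreover have "isCont \<Psi> 0" using cont\<Psi>[of UNIV] continuous_on_eq_continuous_at by blast
      ultimately show "(\<gamma> \<longlongrightarrow> p) at_top"
        using isCont_tendsto_compose \<Psi>0 unfolding \<gamma>_def comp_def by metis
      show "\<gamma> 0 \<noteq> p" using \<gamma>O by blast
    qed
    then show ?thesis using A_eq by metis
  qed
  \<comment> \<open>Reflecting in the horizontal axis and reversing time maps solutions to
    solutions. In the chart the reflection changes the sign of z, so it carries \<open>A\<close> to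
    \<open>B\<close>.\<close>
  have exB: "\<exists>x. is_solution F {..0} x \<and> B = x ` {..0} \<and> (x \<longlongrightarrow> p) at_bot"
  proof -
    obtain x where sol: "is_solution F {0..} x" and A: "A = x ` {0..}" and lim: "(x \<longlongrightarrow> p) at_top"
      using exA by blast
    define m :: "real \<times> real \<Rightarrow> real \<times> real" where "m v = (fst v, - snd v)" for v
    have lin: "bounded_linear m" unfolding m_def[abs_def]
      by (intro bounded_linear_Pair bounded_linear_fst bounded_linear_minus bounded_linear_snd)
    define x' where "x' t = m (x (- t))" for t
    have "is_solution F {..0} x'"
      unfolding is_solution_def
    proof
      fix t :: real assume t: "t \<in> {..0}"
      have im: "uminus ` {..0::real} = {0..}" by simp
      have 1: "(uminus has_vector_derivative - 1) (at t within {..0})"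
        by (auto intro!: derivative_eq_intros simp: has_real_derivative_iff_has_vector_derivative[symmetric])
      have "(x has_vector_derivative F (x (- t))) (at (- t) within uminus ` {..0})"
        unfolding im using sol t by (auto simp: is_solution_def)
      from vector_diff_chain_within[OF 1 this]
      have "((\<lambda>t. x (- t)) has_vector_derivative - F (x (- t))) (at t within {..0})" by (simp add: comp_def)
      from bounded_linear.has_vector_derivative[OF lin this]
      show "(x' has_vector_derivative F (x' t)) (at t within {..0})"
        by (simp add: x'_def[abs_def] m_def revF)
    qed
    moreover have "B = x' ` {..0}"
    proof -
      have m\<Psi>: "m (\<Psi> z) = \<Psi> (- fst z, snd z)" for z
        using rev[OF \<Psi>O[of z]] \<Psi>\<Phi> \<Phi>\<Psi> by (metis m_def)
      have "{0<..1} \<times> {0} = (\<lambda>z. (- fst z, snd z)) ` ({- 1..<0::real} \<times> {0::real})"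
      proof (intro equalityI subsetI)
        fix z :: "real \<times> real" assume "z \<in> {0<..1} \<times> {0}"
        then have "z = (- fst (- fst z, snd z), snd (- fst z, snd z))" "(- fst z, snd z) \<in> {- 1..<0} \<times> {0}" by auto
        then show "z \<in> (\<lambda>z. (- fst z, snd z)) ` ({- 1..<0} \<times> {0})" by blast
      qed auto
      then have "B = m ` A" by (simp add: B_def A_def image_image m\<Psi>)
      also have "\<dots> = m ` x ` uminus ` {..0}" by (simp add: A)
      also have "\<dots> = x' ` {..0}" unfolding x'_def image_image ..
      finally show ?thesis .
    qed
    moreover have "(x' \<longlongrightarrow> p) at_bot"
    proof -
      have "((\<lambda>t. x (- t)) \<longlongrightarrow> p) at_bot"
        using lim filterlim_at_bot_mirror[of x "nhds p"] filterlim_compose filterlim_uminus_at_top_at_bot by blast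
      from bounded_linear.tendsto[OF lin this] have "(x' \<longlongrightarrow> m p) at_bot" by (simp add: x'_def[abs_def])
      moreover have "m p = p" using rev[OF p(1)] p(2) \<Psi>\<Phi> \<Psi>0 by (metis (no_types) m_def fst_zero snd_zero minus_zero prod.collapse)
      ultimately show ?thesis by simp
    qed
    ultimately show ?thesis by blast
  qed
  have iso: "equilibria F \<inter> O1 = {p}"
  proof (intro equalityI subsetI)
    fix x assume x: "x \<in> equilibria F \<inter> O1"
    show "x \<in> {p}"
    proof (rule ccontr)
      assume "x \<notin> {p}"
      then have xO: "x \<in> O1 - {p}" using x by blast
      have "F x = 0" using x by (simp add: equilibria_def)
      then have "\<kappa> x *\<^sub>R (1, 0) = (0 :: real \<times> real)"
        using push[OF xO] linear_0[OF has_derivative_linear[OF deriv[OF xO]]] by simp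
      then show False using pos[OF xO] by (simp add: zero_prod_def)
    qed
  qed (use Fp p in \<open>auto simp: equilibria_def\<close>)
  have sectors: "\<exists>S1 S2 A B. p \<in> interior (S1 \<union> S2) \<and> S1 \<inter> S2 = {p} \<union> A \<union> B \<and>
      hyperbolic_sector F p S1 A B \<and> hyperbolic_sector F p S2 A B \<and>
      (\<exists>x. is_solution F {0..} x \<and> A = x ` {0..} \<and> (x \<longlongrightarrow> p) at_top) \<and>
      (\<exists>x. is_solution F {..0} x \<and> B = x ` {..0} \<and> (x \<longlongrightarrow> p) at_bot)"
    by (rule exI[of _ "h 1 ` Q"], rule exI[of _ "h (- 1) ` Q"], rule exI[of _ A], rule exI[of _ B],
        intro conjI int inter exA exB sector) simp_all
  have "p \<in> equilibria F" using iso by blast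
  moreover have "\<exists>W. open W \<and> p \<in> W \<and> equilibria F \<inter> W = {p}" using op p(1) iso by blast
  ultimately show ?thesis unfolding is_cusp_def using sectors by (intro conjI)
qed

section \<open>The degenerate equilibrium and the classification\<close>

text \<open>With t = sqrt(v w) the strict inequality v + w > 2 t of the means reduces the claim to 2
  t^3 - 3 U t^2 + U^3 = (t - U)^2 (2 t + U) \<ge> 0.\<close>

lemma cusp_potential_factor_pos:
  fixes v w U :: real
  assumes "0 < v" "0 < w" "v \<noteq> w" "U > 0"
  shows "v * w * (v + w) - 3 * U * (v * w) + U ^ 3 > 0"
proof -
  define t where "t = sqrt (v * w)"
  have t: "t > 0" "t\<^sup>2 = v * w" using assms by (simp_all add: t_def)
  have "(v + w)\<^sup>2 = (2 * t)\<^sup>2 + (v - w)\<^sup>2"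
    by (simp add: power_mult_distrib t(2)) (simp add: power2_eq_square algebra_simps)
  moreover have "(v - w)\<^sup>2 > 0" using assms by simp
  ultimately have "(2 * t)\<^sup>2 < (v + w)\<^sup>2" by linarith
  then have "2 * t < v + w" by (rule power2_less_imp_less) (use assms in auto)
  then have "t\<^sup>2 * (2 * t) < v * w * (v + w)" using t assms by simp
  moreover have "t\<^sup>2 * (2 * t) - 3 * U * t\<^sup>2 + U ^ 3 = (t - U)\<^sup>2 * (2 * t + U)"
    by (simp add: power2_eq_square power3_eq_cube algebra_simps)
  moreover have "(t - U)\<^sup>2 * (2 * t + U) \<ge> 0" using t assms by simp
  ultimately show ?thesis using t(2) by simp
qed

text \<open>For v = \<phi>^2, U = u^2 and z = |\<phi>| y the quotient is the energy c. After
  clearing denominators the difference of the two sides is (w - v) times a quantity that is positive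
  by \<open>cusp_potential_factor_pos\<close>.\<close>

lemma cusp_energy_inj:
  fixes v w U m z :: real
  assumes "0 < v" "0 < w" "U > 0" "m > 0"
    and eq: "(z\<^sup>2 - m * (v - U) ^ 3) / v = (z\<^sup>2 - m * (w - U) ^ 3) / w"
  shows "v = w"
proof (rule ccontr)
  assume "v \<noteq> w"
  have "w * (z\<^sup>2 - m * (v - U) ^ 3) = v * (z\<^sup>2 - m * (w - U) ^ 3)"
    using eq assms(1,2) by (simp add: field_simps)
  moreover have "w * (z\<^sup>2 - m * (v - U) ^ 3) - v * (z\<^sup>2 - m * (w - U) ^ 3)
      = (w - v) * (z\<^sup>2 + m * (v * w * (v + w) - 3 * U * (v * w) + U ^ 3))"
    by (simp add: power2_eq_square power3_eq_cube algebra_simps)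
  ultimately have "z\<^sup>2 + m * (v * w * (v + w) - 3 * U * (v * w) + U ^ 3) = 0"
    using \<open>v \<noteq> w\<close> by simp
  moreover have "m * (v * w * (v + w) - 3 * U * (v * w) + U ^ 3) > 0"
    using cusp_potential_factor_pos[OF assms(1,2) \<open>v \<noteq> w\<close> assms(3)] assms(4) by simp
  moreover have "z\<^sup>2 \<ge> 0" by simp
  ultimately show False by linarith
qed

text \<open>Intermediate values for the equation with the denominator cleared: the difference
  \<open>N\<close> is positive at 0, and for large v the cubic term makes it nonpositive.\<close>

lemma cusp_energy_surj:
  fixes U m z c :: real
  assumes "U > 0" "m > 0"
  obtains v where "v > 0" "c = (z\<^sup>2 - m * (v - U) ^ 3) / v"
proof -
  define N where "N v = z\<^sup>2 - m * (v - U) ^ 3 - c * v" for v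
  \<comment> \<open>Chosen so that z^2 + |c| (U + k) \<le> a k whenever k \<ge> 1; then k = 1 + a/m
    gives a \<le> m k, and hence a k \<le> m k^3.\<close>
  define a where "a = z\<^sup>2 + \<bar>c\<bar> * (U + 1)"
  define k where "k = 1 + a / m"
  have a: "a \<ge> 0" using assms by (simp add: a_def)
  have k: "k \<ge> 1" "m * k = m + a" using a assms by (simp_all add: k_def field_simps)
  have "N 0 > 0"
  proof -
    have "N 0 = z\<^sup>2 + m * U ^ 3" by (simp add: N_def power3_eq_cube)
    moreover have "m * U ^ 3 > 0" using assms by simp
    moreover have "z\<^sup>2 \<ge> 0" by simp
    ultimately show ?thesis by linarith
  qed
  moreover have "N (U + k) \<le> 0"
  proof -
    have "z\<^sup>2 + \<bar>c\<bar> * (U + k) \<le> a * k"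
    proof -
      have "a * k - (z\<^sup>2 + \<bar>c\<bar> * (U + k)) = z\<^sup>2 * (k - 1) + \<bar>c\<bar> * U * (k - 1)"
        by (simp add: a_def algebra_simps)
      moreover have "z\<^sup>2 * (k - 1) \<ge> 0" "\<bar>c\<bar> * U * (k - 1) \<ge> 0" using k assms by simp_all
      ultimately show ?thesis by linarith
    qed
    also have "\<dots> \<le> (m * k) * k" using k assms by (intro mult_right_mono) auto
    also have "\<dots> \<le> (m * k) * k * k" using mult_left_mono[of 1 k "m * k * k"] k(1) assms by simp
    also have "\<dots> = m * (U + k - U) ^ 3" by (simp add: power3_eq_cube)
    finally have 1: "z\<^sup>2 + \<bar>c\<bar> * (U + k) \<le> m * (U + k - U) ^ 3" .
    have "- c * (U + k) \<le> \<bar>c\<bar> * (U + k)" using k assms by (intro mult_right_mono) auto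
    then show ?thesis using 1 unfolding N_def by linarith
  qed
  moreover have "continuous_on {0..U + k} N" unfolding N_def by (intro continuous_intros)
  ultimately obtain v where v: "0 \<le> v" "N v = 0"
    using IVT2'[of N "U + k" 0 0] k assms by auto
  then have "v > 0" using \<open>N 0 > 0\<close> by (cases "v = 0") auto
  then show thesis using that[of v] v by (simp add: N_def field_simps)
qed

text \<open>The relations for \<open>\<alpha>\<^sub>2\<close> and \<open>\<alpha>\<^sub>3\<close>
  say that u^2 is a double root of g as a cubic in \<phi>^2. So g does not change sign at u, which
  is what makes z' positive around the equilibrium.\<close>

lemma planar_field_cusp:
  fixes \<alpha>\<^sub>1 u :: real
  assumes u: "u \<noteq> 0" and \<alpha>\<^sub>1: "\<alpha>\<^sub>1 > 0"
    and \<alpha>\<^sub>2: "\<alpha>\<^sub>2 = - (3 / 2) * \<alpha>\<^sub>1 * u\<^sup>2" and \<alpha>\<^sub>3: "\<alpha>\<^sub>3 = \<alpha>\<^sub>1 * u ^ 6 / 2"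
  shows "is_cusp (planar_field \<alpha>\<^sub>1 \<alpha>\<^sub>2 \<alpha>\<^sub>3) (u, 0)"
proof -
  let ?F = "planar_field \<alpha>\<^sub>1 \<alpha>\<^sub>2 \<alpha>\<^sub>3"
  define g where "g \<phi> = \<alpha>\<^sub>1 * (\<phi>\<^sup>2 - u\<^sup>2)\<^sup>2 * (\<phi>\<^sup>2 + u\<^sup>2 / 2)" for \<phi>
  have F: "?F x = (fst x ^ 3 * snd x, g (fst x))" for x
    by (simp add: planar_field_def case_prod_beta g_def \<alpha>\<^sub>2 \<alpha>\<^sub>3 power2_eq_square algebra_simps eval_nat_numeral)
  have g_nonneg: "g \<phi> \<ge> 0" for \<phi> using \<alpha>\<^sub>1 by (simp add: g_def)
  have g_zero: "g \<phi> = 0 \<longleftrightarrow> \<phi>\<^sup>2 = u\<^sup>2" for \<phi>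
  proof -
    have "u\<^sup>2 / 2 > 0" "\<phi>\<^sup>2 \<ge> 0" using u by simp_all
    then have "\<phi>\<^sup>2 + u\<^sup>2 / 2 \<noteq> 0" by linarith
    then show ?thesis using \<alpha>\<^sub>1 by (simp add: g_def)
  qed
  \<comment> \<open>With the sign of \<open>u\<close>, \<sigma> \<phi> is |\<phi>| on the half plane
    containing \<open>u\<close>, and one argument covers both equilibria.\<close>
  define \<sigma> where "\<sigma> = sgn u"
  have \<sigma>: "\<sigma> * \<sigma> = 1" "\<sigma> \<noteq> 0" using u by (auto simp: \<sigma>_def sgn_if)
  define m where "m = \<alpha>\<^sub>1 / 2"
  have m: "m > 0" using \<alpha>\<^sub>1 by (simp add: m_def)
  have U: "u\<^sup>2 > 0" using u by simp
  define V where "V \<phi> = m * (\<phi>\<^sup>2 - u\<^sup>2) ^ 3 / \<phi>\<^sup>2" for \<phi>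
  define \<Phi> where "\<Phi> x = (\<sigma> * (fst x * snd x), (snd x)\<^sup>2 - V (fst x))" for x :: "real \<times> real"
  define D where "D x d = (\<sigma> * (fst x * snd d + fst d * snd x), 2 * snd x * snd d - 2 * g (fst x) / fst x ^ 3 * fst d)"
    for x d :: "real \<times> real"
  define \<kappa> where "\<kappa> x = \<sigma> * fst x * (g (fst x) + (fst x)\<^sup>2 * (snd x)\<^sup>2)" for x :: "real \<times> real"
  define O1 where "O1 = {x::real \<times> real. \<sigma> * fst x > 0}"
  have nz: "fst x \<noteq> 0" if "x \<in> O1" for x using that by (auto simp: O1_def)
  have sq_inj: "\<phi> = \<psi>" if "\<sigma> * \<phi> > 0" "\<sigma> * \<psi> > 0" "\<phi>\<^sup>2 = \<psi>\<^sup>2" for \<phi> \<psi>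
    using that by (auto simp: power2_eq_iff)
  have \<sigma>u: "\<sigma> * u > 0" using u by (simp add: \<sigma>_def sgn_if)
  have dV: "(V has_real_derivative 2 * g \<phi> / \<phi> ^ 3) (at \<phi>)" if "\<phi> \<noteq> 0" for \<phi>
  proof -
    have 1: "((\<lambda>\<phi>. m * (\<phi>\<^sup>2 - u\<^sup>2) ^ 3) has_real_derivative m * (3 * (\<phi>\<^sup>2 - u\<^sup>2)\<^sup>2 * (2 * \<phi>))) (at \<phi>)"
      by (auto intro!: derivative_eq_intros)
    have 2: "((\<lambda>\<phi>. \<phi>\<^sup>2) has_real_derivative 2 * \<phi>) (at \<phi>)" by (auto intro!: derivative_eq_intros)
    have "(V has_real_derivative (m * (3 * (\<phi>\<^sup>2 - u\<^sup>2)\<^sup>2 * (2 * \<phi>)) * \<phi>\<^sup>2 - m * (\<phi>\<^sup>2 - u\<^sup>2) ^ 3 * (2 * \<phi>)) / (\<phi>\<^sup>2)\<^sup>2) (at \<phi>)"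
      using DERIV_quotient[OF 1 2] that by (simp add: V_def[abs_def] numeral_2_eq_2 mult_ac)
    moreover have "(m * (3 * (\<phi>\<^sup>2 - u\<^sup>2)\<^sup>2 * (2 * \<phi>)) * \<phi>\<^sup>2 - m * (\<phi>\<^sup>2 - u\<^sup>2) ^ 3 * (2 * \<phi>)) * \<phi> ^ 3
        = 2 * g \<phi> * (\<phi>\<^sup>2)\<^sup>2"
      by (simp add: g_def m_def power2_eq_square power3_eq_cube algebra_simps)
    then have "(m * (3 * (\<phi>\<^sup>2 - u\<^sup>2)\<^sup>2 * (2 * \<phi>)) * \<phi>\<^sup>2 - m * (\<phi>\<^sup>2 - u\<^sup>2) ^ 3 * (2 * \<phi>)) / (\<phi>\<^sup>2)\<^sup>2 = 2 * g \<phi> / \<phi> ^ 3"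
      using that by (simp add: frac_eq_eq)
    ultimately show ?thesis by simp
  qed
  have deriv: "(\<Phi> has_derivative D x) (at x)" if "x \<in> O1" for x
  proof -
    have fst': "(fst has_derivative fst) (at x)" and snd': "(snd has_derivative snd) (at x)"
      by (intro bounded_linear_imp_has_derivative bounded_linear_fst bounded_linear_snd)+
    have 1: "((\<lambda>x. \<sigma> * (fst x * snd x)) has_derivative (\<lambda>d. \<sigma> * (fst x * snd d + fst d * snd x))) (at x)"
      by (intro has_derivative_mult_right has_derivative_mult fst' snd')
    have "((\<lambda>y. y\<^sup>2) has_real_derivative 2 * snd x) (at (snd x))" by (auto intro!: derivative_eq_intros)
    from has_derivative_diff[OF DERIV_compose_FDERIV[OF this snd'] DERIV_compose_FDERIV[OF dV[OF nz[OF that]] fst']]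
    have "((\<lambda>x. (snd x)\<^sup>2 - V (fst x)) has_derivative
        (\<lambda>d. snd d * (2 * snd x) - fst d * (2 * g (fst x) / fst x ^ 3))) (at x)" .
    from has_derivative_Pair[OF 1 this] show ?thesis
      by (simp add: \<Phi>_def[abs_def] D_def[abs_def] mult.commute)
  qed
  \<comment> \<open>The energy rewritten in z and \<phi>^2, the form to which
    \<open>cusp_energy_inj\<close> and \<open>cusp_energy_surj\<close> apply.\<close>
  have z2: "(snd x)\<^sup>2 - V (fst x) = ((\<sigma> * (fst x * snd x))\<^sup>2 - m * ((fst x)\<^sup>2 - u\<^sup>2) ^ 3) / (fst x)\<^sup>2" if "x \<in> O1" for x
  proof -
    have "(\<sigma> * (fst x * snd x))\<^sup>2 = (fst x)\<^sup>2 * (snd x)\<^sup>2"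
      using \<sigma>(1) by (simp add: power_mult_distrib) (simp add: power2_eq_square)
    then show ?thesis using nz[OF that] by (simp add: V_def diff_divide_distrib)
  qed
  have \<kappa>_pos: "\<kappa> x > 0" if "x \<in> O1 - {(u, 0)}" for x
  proof -
    have x: "\<sigma> * fst x > 0" "x \<noteq> (u, 0)" using that by (auto simp: O1_def)
    \<comment> \<open>On this half plane g vanishes only for \<phi> = u, and there the second
      summand takes over unless y = 0.\<close>
    have "g (fst x) \<noteq> 0 \<or> snd x \<noteq> 0"
      using x sq_inj[OF x(1) \<sigma>u] g_zero[of "fst x"] by (auto simp: prod_eq_iff)
    then have "g (fst x) + (fst x)\<^sup>2 * (snd x)\<^sup>2 > 0"
    proof
      assume "g (fst x) \<noteq> 0"
      then have "g (fst x) > 0" using g_nonneg[of "fst x"] by linarith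
      moreover have "(fst x)\<^sup>2 * (snd x)\<^sup>2 \<ge> 0" by simp
      ultimately show ?thesis by linarith
    next
      assume "snd x \<noteq> 0"
      moreover have "fst x \<noteq> 0" using x(1) by auto
      ultimately have "(fst x)\<^sup>2 * (snd x)\<^sup>2 > 0" by simp
      then show ?thesis using g_nonneg[of "fst x"] by linarith
    qed
    then show ?thesis using x(1) by (simp add: \<kappa>_def)
  qed
  show ?thesis
  proof (rule is_cusp_horizontal[of O1 \<Phi> "(u, 0)" D ?F \<kappa>])
    show "open O1" unfolding O1_def by (intro open_Collect_less continuous_intros)
    show "inj_on \<Phi> O1"
    proof (rule inj_onI)
      fix x y assume xy: "x \<in> O1" "y \<in> O1" "\<Phi> x = \<Phi> y"
      then have z: "\<sigma> * (fst x * snd x) = \<sigma> * (fst y * snd y)" and c: "(snd x)\<^sup>2 - V (fst x) = (snd y)\<^sup>2 - V (fst y)"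
        by (simp_all add: \<Phi>_def)
      have "(fst x)\<^sup>2 = (fst y)\<^sup>2"
        by (rule cusp_energy_inj[OF _ _ U m]) (use nz xy z2 c z in auto)
      then have "fst x = fst y" using sq_inj xy by (simp add: O1_def)
      then show "x = y" using z \<sigma> nz[OF xy(2)] by (simp add: prod_eq_iff)
    qed
    show "\<Phi> ` O1 = UNIV"
    proof (rule UNIV_eq_I[symmetric])
      fix w :: "real \<times> real"
      obtain v where v: "v > 0" "snd w = ((fst w)\<^sup>2 - m * (v - u\<^sup>2) ^ 3) / v"
        using cusp_energy_surj[OF U m] by blast
      define x where "x = (\<sigma> * sqrt v, fst w / sqrt v)"
      have fx: "(fst x)\<^sup>2 = v" and "\<sigma> * fst x = \<sigma> * \<sigma> * sqrt v"
        using v \<sigma> by (simp_all add: x_def power_mult_distrib) (simp add: power2_eq_square)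
      then have xO: "x \<in> O1" using v \<sigma> by (simp add: O1_def)
      have "\<sigma> * (fst x * snd x) = \<sigma> * \<sigma> * fst w" using v by (simp add: x_def)
      then have fw: "\<sigma> * (fst x * snd x) = fst w" using \<sigma> by simp
      have "\<Phi> x = w"
        unfolding \<Phi>_def z2[OF xO] fw fx using v(2) by (simp add: prod_eq_iff)
      then show "w \<in> \<Phi> ` O1" using xO by blast
    qed
    show "(u, 0) \<in> O1" "\<Phi> (u, 0) = 0" using \<sigma>u by (simp_all add: O1_def \<Phi>_def V_def zero_prod_def)
    show "continuous_on O1 \<Phi>"
      using deriv by (meson continuous_at_imp_continuous_on has_derivative_continuous)
    show "continuous_on (O1 - {(u, 0)}) \<kappa>" unfolding \<kappa>_def[abs_def] g_def by (intro continuous_intros) auto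
    show "?F (u, 0) = 0" using g_zero[of u] by (simp add: F zero_prod_def)
    show "?F (fst x, - snd x) = (- fst (?F x), snd (?F x))" for x by (simp add: F)
    show "(fst x, - snd x) \<in> O1 \<and> \<Phi> (fst x, - snd x) = (- fst (\<Phi> x), snd (\<Phi> x))" if "x \<in> O1" for x
      using that by (simp add: O1_def \<Phi>_def)
  next
    fix x assume x: "x \<in> O1 - {(u, 0)}"
    then have x0: "fst x \<noteq> 0" using nz by blast
    show "(\<Phi> has_derivative D x) (at x)" using deriv x by blast
    show "\<kappa> x > 0" by (rule \<kappa>_pos[OF x])
    \<comment> \<open>The cancellation in the second component of \<open>D x (?F x)\<close>:
      conservation of energy.\<close>
    have "2 * snd x * g (fst x) - 2 * g (fst x) / fst x ^ 3 * (fst x ^ 3 * snd x) = 0"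
      using x0 by simp
    then show "D x (?F x) = \<kappa> x *\<^sub>R (1, 0)"
      by (simp add: D_def F \<kappa>_def power2_eq_square power3_eq_cube algebra_simps)
    show "inj (D x)"
    proof (rule linear_injective_0[OF has_derivative_linear[OF deriv], THEN iffD2])
      show "x \<in> O1" using x by blast
      show "\<forall>d. D x d = 0 \<longrightarrow> d = 0"
      proof (intro allI impI)
        fix d assume "D x d = 0"
        then have 1: "fst x * snd d + fst d * snd x = 0"
          and 2: "2 * snd x * snd d - 2 * g (fst x) / fst x ^ 3 * fst d = 0"
          using \<sigma> by (simp_all add: D_def zero_prod_def)
        have 3: "snd x * snd d * fst x ^ 3 = g (fst x) * fst d" using 2 x0 by (simp add: field_simps)
        \<comment> \<open>Eliminates \<open>snd d\<close> from the two equations. The remaining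
          coefficient of \<open>fst d\<close> is \<kappa> up to the nonzero factor \<sigma> \<phi>,
          so \<kappa> > 0 also makes the derivative injective.\<close>
        have "fst d * (g (fst x) + (fst x)\<^sup>2 * (snd x)\<^sup>2)
            = snd x * (fst x)\<^sup>2 * (fst x * snd d + fst d * snd x) - (snd x * snd d * fst x ^ 3 - g (fst x) * fst d)"
          by (simp add: power2_eq_square power3_eq_cube algebra_simps)
        also have "\<dots> = 0" by (simp add: 1 3)
        finally have "fst d = 0" using \<kappa>_pos[OF x] by (auto simp: \<kappa>_def)
        then show "d = 0" using 1 x0 by (simp add: zero_prod_def prod_eq_iff)
      qed
    qed
  next
    fix S :: "(real \<times> real) set" assume S: "compact S"
    \<comment> \<open>The first component contains the factor y and g contains \<phi> - u;
      \<open>b\<close> collects the cofactors, which are bounded on compact sets.\<close>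
    define b where "b x = \<bar>fst x\<bar> ^ 3 + \<bar>\<alpha>\<^sub>1 * (fst x - u) * (fst x + u)\<^sup>2 * ((fst x)\<^sup>2 + u\<^sup>2 / 2)\<bar>" for x :: "real \<times> real"
    have "continuous_on S b" unfolding b_def by (intro continuous_intros) auto
    then have "bounded (b ` S)" using S compact_continuous_image compact_imp_bounded by blast
    then obtain K where K: "\<And>x. x \<in> S \<Longrightarrow> b x \<le> K" by (force simp: bounded_iff abs_le_iff)
    have "norm (?F x) \<le> K * norm (x - (u, 0))" if "x \<in> S" for x
    proof -
      have "norm (?F x) \<le> \<bar>fst x ^ 3 * snd x\<bar> + \<bar>g (fst x)\<bar>"
        unfolding F using norm_Pair_le[of "fst x ^ 3 * snd x" "g (fst x)"] by simp
      also have "g (fst x) = \<alpha>\<^sub>1 * (fst x - u) * (fst x + u)\<^sup>2 * ((fst x)\<^sup>2 + u\<^sup>2 / 2) * (fst x - u)"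
      proof -
        have "((fst x)\<^sup>2 - u\<^sup>2)\<^sup>2 = (fst x - u) * (fst x + u)\<^sup>2 * (fst x - u)"
          by (simp add: power2_eq_square algebra_simps)
        then show ?thesis by (simp add: g_def mult_ac)
      qed
      also have "\<bar>fst x ^ 3 * snd x\<bar> + \<bar>\<dots>\<bar> \<le> b x * norm (x - (u, 0))"
      proof -
        have "x - (u, 0) = (fst x - u, snd x)" by (simp add: prod_eq_iff)
        then have "\<bar>snd x\<bar> \<le> norm (x - (u, 0))" "\<bar>fst x - u\<bar> \<le> norm (x - (u, 0))"
          using norm_fst_le[of "fst x - u" "snd x"] norm_snd_le[of "snd x" "fst x - u"] by simp_all
        then show ?thesis unfolding b_def abs_mult power_abs distrib_right
          by (intro add_mono mult_left_mono) auto
      qed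
      also have "\<dots> \<le> K * norm (x - (u, 0))" using K[OF that] by (intro mult_right_mono) auto
      finally show ?thesis .
    qed
    then show "\<exists>K. \<forall>x\<in>S. norm (?F x) \<le> K * norm (x - (u, 0))" by blast
  qed
qed

section \<open>Equilibria as roots of a cubic in \<phi>^2, and the four parameter regimes\<close>

lemma planar_field_equilibria:
  assumes "\<alpha>\<^sub>3 \<noteq> 0"
  shows "equilibria (planar_field \<alpha>\<^sub>1 \<alpha>\<^sub>2 \<alpha>\<^sub>3) = {(\<phi>, 0) |\<phi>. \<alpha>\<^sub>1 * (\<phi>\<^sup>2) ^ 3 + \<alpha>\<^sub>2 * (\<phi>\<^sup>2)\<^sup>2 + \<alpha>\<^sub>3 = 0}"
proof -
  have "planar_field \<alpha>\<^sub>1 \<alpha>\<^sub>2 \<alpha>\<^sub>3 (\<phi>, y) = 0 \<longleftrightarrow>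
      y = 0 \<and> \<alpha>\<^sub>1 * (\<phi>\<^sup>2) ^ 3 + \<alpha>\<^sub>2 * (\<phi>\<^sup>2)\<^sup>2 + \<alpha>\<^sub>3 = 0" for \<phi> y
  proof (cases "\<phi> = 0")
    case False
    have "\<phi> ^ 6 = (\<phi>\<^sup>2) ^ 3" "\<phi> ^ 4 = (\<phi>\<^sup>2)\<^sup>2" by (simp_all flip: power_mult)
    then show ?thesis using False by (simp only: planar_field_def prod.case zero_prod_def prod.inject) simp
  qed (use assms in \<open>simp add: planar_field_def zero_prod_def\<close>)
  then show ?thesis unfolding equilibria_def by auto
qed

text \<open>Reduces the count of equilibria to the nonnegative roots of the cubic; every positive
  root yields one symmetric pair.\<close>

lemma planar_field_equilibria_sqrt:
  assumes "\<alpha>\<^sub>3 \<noteq> 0" and "\<And>v. v \<in> R \<Longrightarrow> v > 0"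
    and "\<And>v. v \<ge> 0 \<Longrightarrow> \<alpha>\<^sub>1 * v ^ 3 + \<alpha>\<^sub>2 * v\<^sup>2 + \<alpha>\<^sub>3 = 0 \<longleftrightarrow> v \<in> R"
  shows "equilibria (planar_field \<alpha>\<^sub>1 \<alpha>\<^sub>2 \<alpha>\<^sub>3) = (\<Union>v\<in>R. {(sqrt v, 0), (- sqrt v, 0)})"
proof -
  have "\<phi>\<^sup>2 \<in> R \<longleftrightarrow> (\<exists>v\<in>R. \<phi> = sqrt v \<or> \<phi> = - sqrt v)" for \<phi>
  proof
    assume "\<phi>\<^sup>2 \<in> R"
    moreover have "\<phi> = sqrt (\<phi>\<^sup>2) \<or> \<phi> = - sqrt (\<phi>\<^sup>2)" by auto
    ultimately show "\<exists>v\<in>R. \<phi> = sqrt v \<or> \<phi> = - sqrt v" by blast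
  next
    assume "\<exists>v\<in>R. \<phi> = sqrt v \<or> \<phi> = - sqrt v"
    then obtain v where v: "v \<in> R" "\<phi> = sqrt v \<or> \<phi> = - sqrt v" by blast
    then have "\<phi>\<^sup>2 = v" using assms(2)[OF v(1)] by auto
    then show "\<phi>\<^sup>2 \<in> R" using v by simp
  qed
  then have "{(\<phi>, 0 :: real) |\<phi>. \<phi>\<^sup>2 \<in> R} = (\<Union>v\<in>R. {(sqrt v, 0), (- sqrt v, 0)})" by auto
  then show ?thesis
    unfolding planar_field_equilibria[OF assms(1)] assms(3)[OF zero_le_power2] .
qed

theorem theorem2:
  fixes \<alpha>\<^sub>1 \<alpha>\<^sub>2 \<alpha>\<^sub>3 :: real
  assumes "\<alpha>\<^sub>3 > 0"
  shows "(\<alpha>\<^sub>1 > 0 \<and> \<alpha>\<^sub>2 < 0 \<and> 0 < \<alpha>\<^sub>3 \<and> \<alpha>\<^sub>3 < - (4 * \<alpha>\<^sub>2 ^ 3 / (27 * \<alpha>\<^sub>1\<^sup>2)) \<longrightarrow>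
           (\<exists>u\<^sub>1 u\<^sub>2. u\<^sub>1 > 0 \<and> u\<^sub>2 > 0 \<and> u\<^sub>1 \<noteq> u\<^sub>2 \<and>
             equilibria (planar_field \<alpha>\<^sub>1 \<alpha>\<^sub>2 \<alpha>\<^sub>3) = {(u\<^sub>1, 0), (- u\<^sub>1, 0), (u\<^sub>2, 0), (- u\<^sub>2, 0)} \<and>
             is_center (planar_field \<alpha>\<^sub>1 \<alpha>\<^sub>2 \<alpha>\<^sub>3) (u\<^sub>1, 0) \<and>
             is_center (planar_field \<alpha>\<^sub>1 \<alpha>\<^sub>2 \<alpha>\<^sub>3) (- u\<^sub>1, 0) \<and>
             is_saddle (planar_field \<alpha>\<^sub>1 \<alpha>\<^sub>2 \<alpha>\<^sub>3) (u\<^sub>2, 0) \<and>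
             is_saddle (planar_field \<alpha>\<^sub>1 \<alpha>\<^sub>2 \<alpha>\<^sub>3) (- u\<^sub>2, 0))) \<and>
         (\<alpha>\<^sub>1 > 0 \<and> \<alpha>\<^sub>2 < 0 \<and> \<alpha>\<^sub>3 = - (4 * \<alpha>\<^sub>2 ^ 3 / (27 * \<alpha>\<^sub>1\<^sup>2)) \<longrightarrow>
           (\<exists>u\<^sub>3. u\<^sub>3 > 0 \<and>
             equilibria (planar_field \<alpha>\<^sub>1 \<alpha>\<^sub>2 \<alpha>\<^sub>3) = {(u\<^sub>3, 0), (- u\<^sub>3, 0)} \<and>
             is_cusp (planar_field \<alpha>\<^sub>1 \<alpha>\<^sub>2 \<alpha>\<^sub>3) (u\<^sub>3, 0) \<and>
             is_cusp (planar_field \<alpha>\<^sub>1 \<alpha>\<^sub>2 \<alpha>\<^sub>3) (- u\<^sub>3, 0))) \<and>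
         ((\<alpha>\<^sub>1 > 0 \<and> \<alpha>\<^sub>2 \<ge> 0) \<or>
          (\<alpha>\<^sub>1 > 0 \<and> \<alpha>\<^sub>2 < 0 \<and> \<alpha>\<^sub>3 > - (4 * \<alpha>\<^sub>2 ^ 3 / (27 * \<alpha>\<^sub>1\<^sup>2))) \<longrightarrow>
           equilibria (planar_field \<alpha>\<^sub>1 \<alpha>\<^sub>2 \<alpha>\<^sub>3) = {}) \<and>
         (\<alpha>\<^sub>1 < 0 \<longrightarrow>
           (\<exists>u\<^sub>4. u\<^sub>4 > 0 \<and>
             equilibria (planar_field \<alpha>\<^sub>1 \<alpha>\<^sub>2 \<alpha>\<^sub>3) = {(u\<^sub>4, 0), (- u\<^sub>4, 0)} \<and>
             is_center (planar_field \<alpha>\<^sub>1 \<alpha>\<^sub>2 \<alpha>\<^sub>3) (u\<^sub>4, 0) \<and>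
             is_center (planar_field \<alpha>\<^sub>1 \<alpha>\<^sub>2 \<alpha>\<^sub>3) (- u\<^sub>4, 0)))"
proof (intro conjI impI)
  let ?F = "planar_field \<alpha>\<^sub>1 \<alpha>\<^sub>2 \<alpha>\<^sub>3"
  \<comment> \<open>Since P'(v) = v (3 \<open>\<alpha>\<^sub>1\<close> v + 2
    \<open>\<alpha>\<^sub>2\<close>), the expression that separates centers from saddles has the
    sign of P' at the root.\<close>
  define P where "P v = \<alpha>\<^sub>1 * v ^ 3 + \<alpha>\<^sub>2 * v\<^sup>2 + \<alpha>\<^sub>3" for v
  have \<alpha>\<^sub>3: "\<alpha>\<^sub>3 \<noteq> 0" using assms by simp
  have P0: "P 0 > 0" using assms by (simp add: P_def)
  have contP: "continuous_on S P" for S unfolding P_def[abs_def] by (intro continuous_intros)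
  have pow: "\<alpha>\<^sub>1 * \<phi> ^ 6 + \<alpha>\<^sub>2 * \<phi> ^ 4 + \<alpha>\<^sub>3 = P (\<phi>\<^sup>2)" for \<phi>
    by (simp add: P_def power_mult[symmetric])
  have center: "is_center ?F (u, 0)" if "u\<^sup>2 = v" "v > 0" "P v = 0" "3 * \<alpha>\<^sub>1 * v + 2 * \<alpha>\<^sub>2 < 0" for u v
    by (rule planar_field_center) (use that pow[of u] in auto)
  have saddle: "is_saddle ?F (u, 0)" if "u\<^sup>2 = v" "v > 0" "P v = 0" "3 * \<alpha>\<^sub>1 * v + 2 * \<alpha>\<^sub>2 > 0" for u v
    by (rule planar_field_saddle) (use that pow[of u] in auto)
  {
    assume A: "\<alpha>\<^sub>1 > 0 \<and> \<alpha>\<^sub>2 < 0 \<and> 0 < \<alpha>\<^sub>3 \<and> \<alpha>\<^sub>3 < - (4 * \<alpha>\<^sub>2 ^ 3 / (27 * \<alpha>\<^sub>1\<^sup>2))"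
    \<comment> \<open>The positive critical point of \<open>P\<close>, its minimum on v \<ge> 0. The
      assumed bound on \<open>\<alpha>\<^sub>3\<close> is exactly \<open>P w < 0\<close>.\<close>
    define w where "w = - 2 * \<alpha>\<^sub>2 / (3 * \<alpha>\<^sub>1)"
    have w: "w > 0" "3 * \<alpha>\<^sub>1 * w = - 2 * \<alpha>\<^sub>2" using A by (simp_all add: w_def field_simps)
    have "P w = \<alpha>\<^sub>3 + 4 * \<alpha>\<^sub>2 ^ 3 / (27 * \<alpha>\<^sub>1\<^sup>2)"
      using A by (simp add: P_def w_def field_simps power2_eq_square power3_eq_cube)
    then have Pw: "P w < 0" using A by simp
    \<comment> \<open>Here the two leading terms of \<open>P\<close> cancel, so \<open>P M\<close>
      is \<open>\<alpha>\<^sub>3\<close>.\<close>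
    define M where "M = - \<alpha>\<^sub>2 / \<alpha>\<^sub>1"
    have M: "M > w" "P M > 0"
      using A by (simp_all add: M_def w_def P_def field_simps power2_eq_square power3_eq_cube)
    obtain v1 where v1: "0 \<le> v1" "v1 \<le> w" "P v1 = 0"
      using IVT2'[of P w 0 0] Pw P0 w contP by auto
    obtain v2 where v2: "w \<le> v2" "v2 \<le> M" "P v2 = 0"
      using IVT'[of P w 0 M] Pw M contP by auto
    have v12: "0 < v1" "v1 < w" "w < v2"
      using v1 v2 P0 Pw by (metis less_irrefl order_le_less)+
    \<comment> \<open>Divided differences of three distinct roots give two of Vieta's relations. The
      second, v v1 + v v2 + v1 v2 = 0, is impossible for v \<ge> 0 and v1, v2 > 0.\<close>
    have uniq: "v = v1 \<or> v = v2" if v: "v \<ge> 0" "P v = 0" for v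
    proof (rule ccontr)
      assume "\<not> ?thesis"
      then have ne: "v \<noteq> v1" "v \<noteq> v2" "v1 \<noteq> v2" using v12 by auto
      have dd: "\<alpha>\<^sub>1 * (a\<^sup>2 + a * b + b\<^sup>2) + \<alpha>\<^sub>2 * (a + b) = 0" if "P a = 0" "P b = 0" "a \<noteq> b" for a b
      proof -
        have "P a - P b = (a - b) * (\<alpha>\<^sub>1 * (a\<^sup>2 + a * b + b\<^sup>2) + \<alpha>\<^sub>2 * (a + b))"
          by (simp add: P_def power2_eq_square power3_eq_cube algebra_simps)
        then show ?thesis using that by simp
      qed
      have "(v1 - v2) * (\<alpha>\<^sub>1 * (v + v1 + v2) + \<alpha>\<^sub>2)
          = (\<alpha>\<^sub>1 * (v\<^sup>2 + v * v1 + v1\<^sup>2) + \<alpha>\<^sub>2 * (v + v1)) - (\<alpha>\<^sub>1 * (v\<^sup>2 + v * v2 + v2\<^sup>2) + \<alpha>\<^sub>2 * (v + v2))"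
        by (simp add: power2_eq_square algebra_simps)
      then have "\<alpha>\<^sub>1 * (v + v1 + v2) + \<alpha>\<^sub>2 = 0"
        using dd[of v v1] dd[of v v2] v v1 v2 ne by simp
      moreover have "\<alpha>\<^sub>1 * (v1\<^sup>2 + v1 * v2 + v2\<^sup>2) + \<alpha>\<^sub>2 * (v1 + v2)
          = (\<alpha>\<^sub>1 * (v + v1 + v2) + \<alpha>\<^sub>2) * (v1 + v2) - \<alpha>\<^sub>1 * (v * (v1 + v2) + v1 * v2)"
        by (simp add: power2_eq_square algebra_simps)
      ultimately have "\<alpha>\<^sub>1 * (v * (v1 + v2) + v1 * v2) = 0"
        using dd[of v1 v2] v1 v2 ne by simp
      moreover have "v * (v1 + v2) \<ge> 0" "v1 * v2 > 0" using v v12 w by simp_all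
      ultimately show False using A by simp
    qed
    have "equilibria ?F = (\<Union>v\<in>{v1, v2}. {(sqrt v, 0), (- sqrt v, 0)})"
      by (rule planar_field_equilibria_sqrt[OF \<alpha>\<^sub>3]) (use uniq v1 v2 v12 w in \<open>auto simp flip: P_def\<close>)
    then have eq: "equilibria ?F = {(sqrt v1, 0), (- sqrt v1, 0), (sqrt v2, 0), (- sqrt v2, 0)}" by auto
    have "3 * \<alpha>\<^sub>1 * v1 < 3 * \<alpha>\<^sub>1 * w" "3 * \<alpha>\<^sub>1 * w < 3 * \<alpha>\<^sub>1 * v2"
      using A v12 by simp_all
    then have s: "3 * \<alpha>\<^sub>1 * v1 + 2 * \<alpha>\<^sub>2 < 0" "3 * \<alpha>\<^sub>1 * v2 + 2 * \<alpha>\<^sub>2 > 0" using w by simp_all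
    show "\<exists>u\<^sub>1 u\<^sub>2. u\<^sub>1 > 0 \<and> u\<^sub>2 > 0 \<and> u\<^sub>1 \<noteq> u\<^sub>2 \<and>
             equilibria ?F = {(u\<^sub>1, 0), (- u\<^sub>1, 0), (u\<^sub>2, 0), (- u\<^sub>2, 0)} \<and>
             is_center ?F (u\<^sub>1, 0) \<and> is_center ?F (- u\<^sub>1, 0) \<and>
             is_saddle ?F (u\<^sub>2, 0) \<and> is_saddle ?F (- u\<^sub>2, 0)"
      using v12 w by (intro exI[of _ "sqrt v1"] exI[of _ "sqrt v2"] conjI eq
          center[OF _ _ v1(3) s(1)] saddle[OF _ _ v2(3) s(2)]) auto
  next
    assume A: "\<alpha>\<^sub>1 > 0 \<and> \<alpha>\<^sub>2 < 0 \<and> \<alpha>\<^sub>3 = - (4 * \<alpha>\<^sub>2 ^ 3 / (27 * \<alpha>\<^sub>1\<^sup>2))"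
    \<comment> \<open>At the critical value of \<open>\<alpha>\<^sub>3\<close> the minimum
      \<open>w\<close> is a double root, and the third root is -w/2.\<close>
    define w where "w = - 2 * \<alpha>\<^sub>2 / (3 * \<alpha>\<^sub>1)"
    have w: "w > 0" and \<alpha>\<^sub>2: "\<alpha>\<^sub>2 = - (3 / 2) * \<alpha>\<^sub>1 * w" using A by (simp_all add: w_def field_simps)
    have \<alpha>3: "\<alpha>\<^sub>3 = \<alpha>\<^sub>1 * w ^ 3 / 2"
      using A by (simp add: w_def field_simps power2_eq_square power3_eq_cube)
    have P: "P v = \<alpha>\<^sub>1 * (v - w)\<^sup>2 * (v + w / 2)" for v
      by (simp add: P_def \<alpha>\<^sub>2 \<alpha>3 power2_eq_square power3_eq_cube algebra_simps)
    have "equilibria ?F = (\<Union>v\<in>{w}. {(sqrt v, 0), (- sqrt v, 0)})"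
    proof (rule planar_field_equilibria_sqrt[OF \<alpha>\<^sub>3])
      fix v :: real assume "v \<ge> 0"
      then have "v + w / 2 \<noteq> 0" using w by linarith
      then show "\<alpha>\<^sub>1 * v ^ 3 + \<alpha>\<^sub>2 * v\<^sup>2 + \<alpha>\<^sub>3 = 0 \<longleftrightarrow> v \<in> {w}"
        unfolding P_def[symmetric] P using A by simp
    qed (use w in auto)
    then have eq: "equilibria ?F = {(sqrt w, 0), (- sqrt w, 0)}" by simp
    have cusp: "is_cusp ?F (u, 0)" if "u\<^sup>2 = w" for u
    proof (rule planar_field_cusp)
      have "u ^ 6 = (u\<^sup>2) ^ 3" by (simp add: power_mult[symmetric])
      then show "\<alpha>\<^sub>3 = \<alpha>\<^sub>1 * u ^ 6 / 2" using \<alpha>3 that by simp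
    qed (use A \<alpha>\<^sub>2 that w in auto)
    show "\<exists>u\<^sub>3. u\<^sub>3 > 0 \<and> equilibria ?F = {(u\<^sub>3, 0), (- u\<^sub>3, 0)} \<and>
             is_cusp ?F (u\<^sub>3, 0) \<and> is_cusp ?F (- u\<^sub>3, 0)"
      using w by (intro exI[of _ "sqrt w"] conjI eq cusp) auto
  next
    assume A: "(\<alpha>\<^sub>1 > 0 \<and> \<alpha>\<^sub>2 \<ge> 0) \<or> (\<alpha>\<^sub>1 > 0 \<and> \<alpha>\<^sub>2 < 0 \<and> \<alpha>\<^sub>3 > - (4 * \<alpha>\<^sub>2 ^ 3 / (27 * \<alpha>\<^sub>1\<^sup>2)))"
    have pos: "P v > 0" if v: "v \<ge> 0" for v
      using A
    proof
      assume B: "\<alpha>\<^sub>1 > 0 \<and> \<alpha>\<^sub>2 \<ge> 0"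
      then have "\<alpha>\<^sub>1 * v ^ 3 \<ge> 0" "\<alpha>\<^sub>2 * v\<^sup>2 \<ge> 0" using v by simp_all
      then show ?thesis using assms unfolding P_def by linarith
    next
      assume B: "\<alpha>\<^sub>1 > 0 \<and> \<alpha>\<^sub>2 < 0 \<and> \<alpha>\<^sub>3 > - (4 * \<alpha>\<^sub>2 ^ 3 / (27 * \<alpha>\<^sub>1\<^sup>2))"
      define w where "w = - 2 * \<alpha>\<^sub>2 / (3 * \<alpha>\<^sub>1)"
      have w: "w > 0" and \<alpha>\<^sub>2: "\<alpha>\<^sub>2 = - (3 / 2) * \<alpha>\<^sub>1 * w" using B by (simp_all add: w_def field_simps)
      have "\<alpha>\<^sub>1 * w ^ 3 / 2 = - (4 * \<alpha>\<^sub>2 ^ 3 / (27 * \<alpha>\<^sub>1\<^sup>2))"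
        using B by (simp add: w_def field_simps power2_eq_square power3_eq_cube)
      then have lt: "\<alpha>\<^sub>1 * w ^ 3 / 2 < \<alpha>\<^sub>3" using B by simp
      \<comment> \<open>The cubic with the critical constant term, nonnegative for v \<ge> 0, plus
        the excess of \<open>\<alpha>\<^sub>3\<close> over the critical value.\<close>
      have "P v = \<alpha>\<^sub>1 * (v - w)\<^sup>2 * (v + w / 2) + (\<alpha>\<^sub>3 - \<alpha>\<^sub>1 * w ^ 3 / 2)"
        by (simp add: P_def \<alpha>\<^sub>2 power2_eq_square power3_eq_cube algebra_simps)
      moreover have "\<alpha>\<^sub>1 * (v - w)\<^sup>2 * (v + w / 2) \<ge> 0" using B v w by simp
      ultimately show ?thesis using lt by linarith
    qed
    have "equilibria ?F = (\<Union>v\<in>{}. {(sqrt v, 0), (- sqrt v, 0)})"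
      by (rule planar_field_equilibria_sqrt[OF \<alpha>\<^sub>3]) (use pos in \<open>auto simp: P_def less_le\<close>)
    then show "equilibria ?F = {}" by simp
  next
    assume A: "\<alpha>\<^sub>1 < 0"
    \<comment> \<open>Chosen with M \<ge> 1 and
      \<open>\<alpha>\<^sub>1 * M + \<alpha>\<^sub>2\<close> at most
      \<open>\<alpha>\<^sub>1 - \<alpha>\<^sub>3\<close>, so that the leading terms outweigh
      \<open>\<alpha>\<^sub>3\<close>.\<close>
    define M where "M = 1 + (\<bar>\<alpha>\<^sub>2\<bar> + \<alpha>\<^sub>3) / (- \<alpha>\<^sub>1)"
    have M: "M \<ge> 1" "\<alpha>\<^sub>1 * M = \<alpha>\<^sub>1 - \<bar>\<alpha>\<^sub>2\<bar> - \<alpha>\<^sub>3" using A assms by (simp_all add: M_def field_simps)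
    have "P M = M\<^sup>2 * (\<alpha>\<^sub>1 * M + \<alpha>\<^sub>2) + \<alpha>\<^sub>3" by (simp add: P_def power2_eq_square power3_eq_cube algebra_simps)
    also have "M\<^sup>2 * (\<alpha>\<^sub>1 * M + \<alpha>\<^sub>2) \<le> 1 * (\<alpha>\<^sub>1 * M + \<alpha>\<^sub>2)"
      by (rule mult_right_mono_neg) (use M A assms in auto)
    also have "1 * (\<alpha>\<^sub>1 * M + \<alpha>\<^sub>2) + \<alpha>\<^sub>3 < 0" using M(2) A abs_ge_self[of \<alpha>\<^sub>2] by simp
    finally have "P M < 0" by simp
    then obtain v where v: "0 \<le> v" "P v = 0" using IVT2'[of P M 0 0] P0 M contP by auto
    then have vpos: "v > 0" using P0 by (cases "v = 0") auto
    have uniq: "t = v" if t: "t \<ge> 0" "P t = 0" for t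
    proof (rule ccontr)
      assume "t \<noteq> v"
      have tpos: "t > 0" using t P0 by (cases "t = 0") auto
      \<comment> \<open>This combination eliminates \<open>\<alpha>\<^sub>2\<close>, whose sign is
        unknown; the cofactor of t - v is negative.\<close>
      have "v\<^sup>2 * P t - t\<^sup>2 * P v = (t - v) * (\<alpha>\<^sub>1 * (t\<^sup>2 * v\<^sup>2) - \<alpha>\<^sub>3 * (t + v))"
        by (simp add: P_def power2_eq_square power3_eq_cube algebra_simps)
      then have "\<alpha>\<^sub>1 * (t\<^sup>2 * v\<^sup>2) - \<alpha>\<^sub>3 * (t + v) = 0" using t v \<open>t \<noteq> v\<close> by simp
      moreover have "\<alpha>\<^sub>1 * (t\<^sup>2 * v\<^sup>2) < 0" using A tpos vpos by (simp add: mult_neg_pos)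
      moreover have "\<alpha>\<^sub>3 * (t + v) > 0" using assms tpos vpos by simp
      ultimately show False by linarith
    qed
    have "equilibria ?F = (\<Union>v\<in>{v}. {(sqrt v, 0), (- sqrt v, 0)})"
    proof (rule planar_field_equilibria_sqrt[OF \<alpha>\<^sub>3])
      fix t :: real assume "t \<ge> 0"
      then show "\<alpha>\<^sub>1 * t ^ 3 + \<alpha>\<^sub>2 * t\<^sup>2 + \<alpha>\<^sub>3 = 0 \<longleftrightarrow> t \<in> {v}"
        using uniq v(2) unfolding P_def[symmetric] by blast
    qed (use vpos in simp)
    then have eq: "equilibria ?F = {(sqrt v, 0), (- sqrt v, 0)}" by simp
    \<comment> \<open>The root equation makes \<open>\<alpha>\<^sub>1 * v + \<alpha>\<^sub>2\<close>
      negative; twice this plus the negative \<open>\<alpha>\<^sub>1 * v\<close> is the center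
      condition.\<close>
    have "v\<^sup>2 * (\<alpha>\<^sub>1 * v + \<alpha>\<^sub>2) = - \<alpha>\<^sub>3"
      using v(2) by (simp add: P_def power2_eq_square power3_eq_cube algebra_simps)
    then have "v\<^sup>2 * (\<alpha>\<^sub>1 * v + \<alpha>\<^sub>2) < 0" using assms by simp
    then have "\<alpha>\<^sub>1 * v + \<alpha>\<^sub>2 < 0" using vpos by (simp add: mult_less_0_iff)
    moreover have "\<alpha>\<^sub>1 * v < 0" using A vpos by (simp add: mult_neg_pos)
    ultimately have s: "3 * \<alpha>\<^sub>1 * v + 2 * \<alpha>\<^sub>2 < 0" by linarith
    show "\<exists>u\<^sub>4. u\<^sub>4 > 0 \<and> equilibria ?F = {(u\<^sub>4, 0), (- u\<^sub>4, 0)} \<and>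
             is_center ?F (u\<^sub>4, 0) \<and> is_center ?F (- u\<^sub>4, 0)"
      using vpos by (intro exI[of _ "sqrt v"] conjI eq center[OF _ _ v(2) s]) auto
  }
qed

end
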